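(* Let $\Bbbk$ be an algebraically closed field of characteristic zero. For each fixed pair of integers $n\ge 2$ and $d\ge 2$, there exists a nonempty Zariski open subset of the parameter space of reduced pairs $(c,q)$ with $\deg(c)=n$ and $\deg_y(q)=d$ such that, for every pair $(c,q)$ in this open subset and every simple derivation $D\in\operatorname{Der}_{\Bbbk}(A_{c,q})$, one has $\operatorname{Aut}_D(A_{c,q})=\{\operatorname{id}\}$.
   Context: For $c\in\Bbbk[x]$ and $q\in\Bbbk[x,y]$, $A_{c,q}=\Bbbk[x,y,z]/(c(x)z-q(x,y))$. For fixed $n,d\ge 2$, a reduced pair $(c,q)$ of degrees $(n,d)$ consists of $c(x)=\sum_{r=0}^{n}c_rx^r$ with $c_r\in\Bbbk$, $c_n\neq0$, $c_{n-1}=0$, and $q(x,y)=\lambda y^d+\sum_{0\le i<n,\ 0\le j\le d-2}q_{ij}x^iy^j$ with $\lambda\in\Bbbk^*$, $q_{ij}\in\Bbbk$. The parameter space of reduced pairs is the set of all such pairs, identified with the open subset $\{c_n\ne 0,\ \lambda\neq 0\}$ of the affine space with coordinates the coefficients $c_r$ ($0\le r\le n$, $r\neq n-1$), $\lambda$ and $q_{ij}$, equipped with the Zariski topology. $\operatorname{Der}_{\Bbbk}(A)$ is the space of $\Bbbk$-derivations of $A$. A derivation $D$ of $A$ is simple if the only ideals $I\subseteq A$ with $D(I)\subseteq I$ are $I=0$ and $I=A$. $\operatorname{Aut}(A)$ is the group of $\Bbbk$-algebra automorphisms of $A$, and $\operatorname{Aut}_D(A)=\{\sigma\in\operatorname{Aut}(A)\mid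 \sigma D=D\sigma\}$ is the isotropy group of $D$. *)

theory Defs
  imports
    "HOL-Algebra.Algebraic_Closure_Type"
    "HOL-Algebra.Bij"
    "HOL-Algebra.QuotRing"
    "HOL-Analysis.Function_Topology"
begin

text \<open>The affine space with coordinates indexed by \<open>I\<close> is the set
  \<open>I \<rightarrow>\<^sub>E UNIV\<close> of extensional functions.\<close>

inductive_set polynomial_functions :: "'i set \<Rightarrow> (('i \<Rightarrow> 'a::comm_ring_1) \<Rightarrow> 'a) set"
  for I :: "'i set" where
  const: "(\<lambda>v. a) \<in> polynomial_functions I"
| coord: "i \<in> I \<Longrightarrow> (\<lambda>v. v i) \<in> polynomial_functions I"
| add: "f \<in> polynomial_functions I \<Longrightarrow> g \<in> polynomial_functions I
    \<Longrightarrow> (\<lambda>v. f v + g v) \<in> polynomial_functions I"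
| mult: "f \<in> polynomial_functions I \<Longrightarrow> g \<in> polynomial_functions I
    \<Longrightarrow> (\<lambda>v. f v * g v) \<in> polynomial_functions I"

definition zero_locus :: "'i set \<Rightarrow> (('i \<Rightarrow> 'a) \<Rightarrow> 'a::comm_ring_1) set \<Rightarrow> ('i \<Rightarrow> 'a) set" where
  "zero_locus I F = {v \<in> I \<rightarrow>\<^sub>E UNIV. \<forall>f\<in>F. f v = 0}"

definition zariski_topology :: "'i set \<Rightarrow> ('i \<Rightarrow> 'a::idom) topology" where
  "zariski_topology I = topology (\<lambda>U. \<exists>F \<subseteq> polynomial_functions I.
     U = (I \<rightarrow>\<^sub>E UNIV) - zero_locus I F)"

lemma istopology_zariski:
  "istopology (\<lambda>U. \<exists>F \<subseteq> polynomial_functions I.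
     U = (I \<rightarrow>\<^sub>E (UNIV :: 'a::idom set)) - zero_locus I F)"
  (is "istopology ?open")
  unfolding istopology_def
proof (intro conjI allI impI)
  fix S T assume "?open S" "?open T"
  then obtain F G where F: "F \<subseteq> polynomial_functions I" "S = (I \<rightarrow>\<^sub>E UNIV) - zero_locus I F"
    and G: "G \<subseteq> polynomial_functions I" "T = (I \<rightarrow>\<^sub>E UNIV) - zero_locus I G"
    by blast
  let ?H = "{\<lambda>v. f v * g v |f g. f \<in> F \<and> g \<in> G}"
  have "?H \<subseteq> polynomial_functions I"
    using F(1) G(1) by (auto intro!: polynomial_functions.mult)
  moreover have "S \<inter> T = (I \<rightarrow>\<^sub>E UNIV) - zero_locus I ?H"
    unfolding F(2) G(2) zero_locus_def by fastforce
  ultimately show "?open (S \<inter> T)"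
    by blast
next
  fix K assume "\<forall>S\<in>K. ?open S"
  then obtain F where F: "\<And>S. S \<in> K \<Longrightarrow> F S \<subseteq> polynomial_functions I"
    "\<And>S. S \<in> K \<Longrightarrow> S = (I \<rightarrow>\<^sub>E UNIV) - zero_locus I (F S)"
    by metis
  have sub: "(\<Union>S\<in>K. F S) \<subseteq> polynomial_functions I"
    using F(1) by blast
  have "(\<Union>S\<in>K. S) = (\<Union>S\<in>K. (I \<rightarrow>\<^sub>E UNIV) - zero_locus I (F S))"
    using F(2) by (rule SUP_cong[OF refl])
  then have "\<Union>K = (I \<rightarrow>\<^sub>E UNIV) - zero_locus I (\<Union>S\<in>K. F S)"
    by (auto simp: zero_locus_def)
  with sub show "?open (\<Union>K)"
    by blast
qed

lemma openin_zariski_iff: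
  "openin (zariski_topology I) U \<longleftrightarrow>
     (\<exists>F \<subseteq> polynomial_functions I. U = (I \<rightarrow>\<^sub>E UNIV) - zero_locus I F)"
  unfolding zariski_topology_def by (simp add: topology_inverse'[OF istopology_zariski])

lemma topspace_zariski [simp]: "topspace (zariski_topology I) = I \<rightarrow>\<^sub>E UNIV"
proof
  show "topspace (zariski_topology I) \<subseteq> I \<rightarrow>\<^sub>E UNIV"
    unfolding topspace_def openin_zariski_iff by blast
  have "openin (zariski_topology I) (I \<rightarrow>\<^sub>E UNIV)"
    unfolding openin_zariski_iff
    by (rule exI[of _ "{\<lambda>v. 1}"]) (auto simp: zero_locus_def intro: polynomial_functions.const)
  then show "I \<rightarrow>\<^sub>E UNIV \<subseteq> topspace (zariski_topology I)"
    by (rule openin_subset)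
qed

text \<open>A polynomial \<open>q(x,y)\<close> is an element of \<open>\<Bbbk>[x][y]\<close>: the coefficient of
  \<open>x^i y^j\<close> is \<open>coeff (coeff q j) i\<close>.\<close>

definition reduced_pairs :: "nat \<Rightarrow> nat \<Rightarrow> ('a::field poly \<times> 'a poly poly) set" where
  "reduced_pairs n d = {(c, q).
     degree c = n \<and> coeff c (n - 1) = 0 \<and>
     (\<exists>l r. l \<noteq> 0 \<and>
        q = monom (monom l 0) d + (\<Sum>i<n. \<Sum>j\<le>d - 2. monom (monom (r i j) i) j))}"

datatype coordinate = C nat | Lam | Q nat nat

definition coordinates :: "nat \<Rightarrow> nat \<Rightarrow> coordinate set" where
  "coordinates n d = C ` ({..n} - {n - 1}) \<union> {Lam} \<union> {Q i j |i j. i < n \<and> j \<le> d - 2}"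

definition coords :: "nat \<Rightarrow> nat \<Rightarrow> 'a::field poly \<times> 'a poly poly \<Rightarrow> coordinate \<Rightarrow> 'a" where
  "coords n d = (\<lambda>(c, q). \<lambda>k\<in>coordinates n d.
     case k of C r \<Rightarrow> coeff c r | Lam \<Rightarrow> coeff (coeff q d) 0 | Q i j \<Rightarrow> coeff (coeff q j) i)"

definition parameter_space :: "nat \<Rightarrow> nat \<Rightarrow> ('a::field poly \<times> 'a poly poly) topology" where
  "parameter_space n d =
     pullback_topology (reduced_pairs n d) (coords n d) (zariski_topology (coordinates n d))"

lemma coeff_reduced_q:
  fixes r :: "nat \<Rightarrow> nat \<Rightarrow> 'a::field"
  assumes "d \<ge> 2"
  shows "coeff (coeff (monom (monom l 0) d +
           (\<Sum>i<n. \<Sum>j\<le>d - 2. monom (monom (r i j) i) j)) b) a =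
         (if b = d then if a = 0 then l else 0
          else if a < n \<and> b \<le> d - 2 then r a b else 0)"
proof -
  have "coeff (coeff (\<Sum>i<n. \<Sum>j\<le>d - 2. monom (monom (r i j) i) j) b) a =
        (\<Sum>i<n. \<Sum>j\<le>d - 2. coeff (coeff (monom (monom (r i j) i) j) b) a)"
    by (simp only: coeff_sum)
  also have "\<dots> = (\<Sum>i<n. \<Sum>j\<le>d - 2. if b = j then if a = i then r i j else 0 else 0)"
    by (intro sum.cong refl) auto
  also have "\<dots> = (\<Sum>i<n. if b \<le> d - 2 then if a = i then r i b else 0 else 0)"
    by (intro sum.cong refl) (simp add: sum.delta')
  also have "\<dots> = (if a < n \<and> b \<le> d - 2 then r a b else 0)"
    by (cases "b \<le> d - 2") simp_all
  finally show ?thesis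
    using assms by (simp only: coeff_add) auto
qed

lemma bij_betw_coords:
  assumes "n \<ge> 2" "d \<ge> 2"
  shows "bij_betw (coords n d) (reduced_pairs n d)
    {v \<in> coordinates n d \<rightarrow>\<^sub>E (UNIV :: 'a::field set). v (C n) \<noteq> 0 \<and> v Lam \<noteq> 0}"
    (is "bij_betw _ _ ?V")
proof (rule bij_betw_imageI)
  show "inj_on (coords n d) (reduced_pairs n d :: ('a poly \<times> 'a poly poly) set)"
  proof (rule inj_onI, safe)
    fix c c' :: "'a poly" and q q' :: "'a poly poly"
    assume cq: "(c, q) \<in> reduced_pairs n d" "(c', q') \<in> reduced_pairs n d"
      and eq: "coords n d (c, q) = coords n d (c', q')"
    note eq' = fun_cong[OF eq]
    show "c = c'"
    proof (rule poly_eqI)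
      fix k
      show "coeff c k = coeff c' k"
        using eq'[of "C k"] cq
        by (cases "k \<le> n"; cases "k = n - 1")
           (auto simp: coords_def coordinates_def reduced_pairs_def coeff_eq_0)
    qed
    obtain l r l' r' where
      q: "q = monom (monom l 0) d + (\<Sum>i<n. \<Sum>j\<le>d - 2. monom (monom (r i j) i) j)" and
      q': "q' = monom (monom l' 0) d + (\<Sum>i<n. \<Sum>j\<le>d - 2. monom (monom (r' i j) i) j)"
      using cq by (auto simp: reduced_pairs_def)
    have coeff_q: "coeff (coeff q b) a =
        (if b = d then if a = 0 then l else 0 else if a < n \<and> b \<le> d - 2 then r a b else 0)"
      and coeff_q': "coeff (coeff q' b) a =
        (if b = d then if a = 0 then l' else 0 else if a < n \<and> b \<le> d - 2 then r' a b else 0)"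
      for a b
      unfolding q q' by (rule coeff_reduced_q[OF assms(2)])+
    show "q = q'"
    proof (rule poly_eqI, rule poly_eqI)
      fix b a
      show "coeff (coeff q b) a = coeff (coeff q' b) a"
        using eq'[of Lam] eq'[of "Q a b"] assms
        by (auto simp: coords_def coordinates_def coeff_q coeff_q' split: if_splits)
    qed
  qed
  show "coords n d ` (reduced_pairs n d :: ('a poly \<times> 'a poly poly) set) = ?V"
  proof (intro equalityI subsetI)
    fix v :: "coordinate \<Rightarrow> 'a" assume "v \<in> coords n d ` reduced_pairs n d"
    then obtain c q l r where v: "v = coords n d (c, q)" and c: "degree c = n"
      and l: "l \<noteq> 0"
      and q: "q = monom (monom l 0) d + (\<Sum>i<n. \<Sum>j\<le>d - 2. monom (monom (r i j) i) j)"
      by (auto simp: reduced_pairs_def)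
    have "coeff c n \<noteq> 0"
      using c assms by auto
    moreover have "coeff (coeff q d) 0 = l"
      unfolding q using coeff_reduced_q[OF assms(2), of l r n d 0] by simp
    ultimately show "v \<in> ?V"
      using l assms by (auto simp: v coords_def coordinates_def)
  next
    fix v :: "coordinate \<Rightarrow> 'a" assume v: "v \<in> ?V"
    define c where "c = (\<Sum>k\<in>{..n} - {n - 1}. monom (v (C k)) k)"
    define q where "q = monom (monom (v Lam) 0) d +
      (\<Sum>i<n. \<Sum>j\<le>d - 2. monom (monom (v (Q i j)) i) j)"
    have coeff_q: "coeff (coeff q b) a = (if b = d then if a = 0 then v Lam else 0
        else if a < n \<and> b \<le> d - 2 then v (Q a b) else 0)" for a b
      unfolding q_def by (rule coeff_reduced_q[OF assms(2)])
    have c: "coeff c k = (if k \<le> n \<and> k \<noteq> n - 1 then v (C k) else 0)" for k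
      by (simp add: c_def coeff_sum)
    have "degree c = n"
      using v assms by (intro antisym degree_le le_degree) (auto simp: c)
    then have "(c, q) \<in> reduced_pairs n d"
      using v by (auto simp: reduced_pairs_def c q_def)
    moreover have "coords n d (c, q) = v"
    proof
      fix k
      show "coords n d (c, q) k = v k"
        using v assms PiE_arb[of v "coordinates n d" _ k]
        by (cases k) (auto simp: coords_def coeff_q c coordinates_def)
    qed
    ultimately show "v \<in> coords n d ` reduced_pairs n d"
      by (metis imageI)
  qed
qed

lemma topspace_parameter_space [simp]: "topspace (parameter_space n d) = reduced_pairs n d"
  by (auto simp: parameter_space_def topspace_pullback_topology coords_def)

text \<open>Elements of \<open>\<Bbbk>[x,y,z]\<close> are elements of \<open>\<Bbbk>[x][y][z]\<close>, with \<open>z\<close> the outermost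
  variable; thus \<open>c(x)z - q(x,y)\<close> is \<open>[:- q, [:c:]:]\<close>.\<close>

abbreviation polynomial_ring_xyz :: "'a::field poly poly poly ring" where
  "polynomial_ring_xyz \<equiv> ring_of_type_algebra"

definition relation_ideal :: "'a::field poly \<Rightarrow> 'a poly poly \<Rightarrow> 'a poly poly poly set" where
  "relation_ideal c q = PIdl\<^bsub>polynomial_ring_xyz\<^esub> [:- q, [:c:]:]"

definition surface_algebra :: "'a::field poly \<Rightarrow> 'a poly poly \<Rightarrow> 'a poly poly poly set ring" where
  "surface_algebra c q = polynomial_ring_xyz Quot relation_ideal c q"

definition scalar :: "'a::field poly \<Rightarrow> 'a poly poly \<Rightarrow> 'a \<Rightarrow> 'a poly poly poly set" where
  "scalar c q a = relation_ideal c q +>\<^bsub>polynomial_ring_xyz\<^esub> [:[:[:a:]:]:]"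

lemma cring_surface_algebra: "cring (surface_algebra c q)"
proof -
  interpret R: cring "polynomial_ring_xyz :: 'a::field poly poly poly ring"
    by (rule cring_from_type_algebra)
  have "ideal (relation_ideal c q) polynomial_ring_xyz"
    unfolding relation_ideal_def
    by (rule R.cgenideal_ideal) (simp add: ring_of_type_algebra_def)
  then show ?thesis
    unfolding surface_algebra_def by (rule ideal.quotient_is_cring) (rule R.is_cring)
qed

text \<open>Self-maps of \<open>A\<close> are taken to be extensional, so that equality of maps is equality on \<open>A\<close>.\<close>

definition derivations ::
  "'a::field poly \<Rightarrow> 'a poly poly \<Rightarrow> ('a poly poly poly set \<Rightarrow> 'a poly poly poly set) set" where
  "derivations c q = (let A = surface_algebra c q in
     {D \<in> carrier A \<rightarrow>\<^sub>E carrier A.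
        (\<forall>f\<in>carrier A. \<forall>g\<in>carrier A. D (f \<oplus>\<^bsub>A\<^esub> g) = D f \<oplus>\<^bsub>A\<^esub> D g) \<and>
        (\<forall>a. \<forall>f\<in>carrier A. D (scalar c q a \<otimes>\<^bsub>A\<^esub> f) = scalar c q a \<otimes>\<^bsub>A\<^esub> D f) \<and>
        (\<forall>f\<in>carrier A. \<forall>g\<in>carrier A.
           D (f \<otimes>\<^bsub>A\<^esub> g) = (D f \<otimes>\<^bsub>A\<^esub> g) \<oplus>\<^bsub>A\<^esub> (f \<otimes>\<^bsub>A\<^esub> D g))})"

definition simple_derivation ::
  "'a::field poly \<Rightarrow> 'a poly poly \<Rightarrow> ('a poly poly poly set \<Rightarrow> 'a poly poly poly set) \<Rightarrow> bool" where
  "simple_derivation c q D \<longleftrightarrow> (let A = surface_algebra c q in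
     D \<in> derivations c q \<and>
     (\<forall>I. ideal I A \<and> D ` I \<subseteq> I \<longrightarrow> I = {\<zero>\<^bsub>A\<^esub>} \<or> I = carrier A))"

definition algebra_automorphisms ::
  "'a::field poly \<Rightarrow> 'a poly poly \<Rightarrow> ('a poly poly poly set \<Rightarrow> 'a poly poly poly set) set" where
  "algebra_automorphisms c q = (let A = surface_algebra c q in
     {\<sigma> \<in> ring_hom A A \<inter> Bij (carrier A). \<forall>a. \<sigma> (scalar c q a) = scalar c q a})"

definition isotropy_group ::
  "'a::field poly \<Rightarrow> 'a poly poly \<Rightarrow> ('a poly poly poly set \<Rightarrow> 'a poly poly poly set)
     \<Rightarrow> ('a poly poly poly set \<Rightarrow> 'a poly poly poly set) set" where
  "isotropy_group c q D = (let A = surface_algebra c q in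
     {\<sigma> \<in> algebra_automorphisms c q. compose (carrier A) \<sigma> D = compose (carrier A) D \<sigma>})"

end

theory Submission
  imports Defs "HOL-Computational_Algebra.Formal_Laurent_Series"
begin

text \<open>Let \<open>A = \<Bbbk>[x,y,z]/(c z - q)\<close>. The open set consists of the reduced pairs for which the
  coefficients of \<open>1\<close> and \<open>x\<close> in \<open>q\<close> are nonzero.

  \<^emph>\<open>Automorphisms are triangular.\<close> Sending \<open>z\<close> to \<open>q/c\<close> embeds \<open>A\<close> into \<open>K[y]\<close> with
  \<open>K = \<Bbbk>((1/x))\<close>. Dividing by \<open>q\<close> with respect to \<open>y\<close> shows that an element of \<open>y\<close>-degree \<open>j\<close> has
  a leading coefficient of \<open>x\<close>-degree at least \<open>-n \<lfloor>j/d\<rfloor>\<close> (\<open>S_pole_bound\<close>). A derivation of \<open>A\<close> is a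
  vector field \<open>P \<partial>\<^sub>x + R \<partial>\<^sub>y\<close>. Compare monomials first by \<open>y\<close>-degree and then by \<open>x\<close>-degree,
  and let the leading part of the field be \<open>p x^(\<alpha>+1) y^\<beta> \<partial>\<^sub>x + r x^\<alpha> y^(\<beta>+1) \<partial>\<^sub>y\<close>. It maps
  \<open>x^k y^j\<close> to \<open>(k p + j r) x^(k+\<alpha>) y^(j+\<beta>)\<close>, so local nilpotency makes the linear form
  \<open>k p + j r\<close> vanish somewhere along the orbit of each of \<open>x\<close>, \<open>y\<close>, \<open>z\<close>. Together with the pole
  bound for \<open>P\<close> and \<open>R\<close> this is impossible when \<open>n, d \<ge> 2\<close>, unless \<open>P = 0\<close>: every locally nilpotent
  derivation kills \<open>x\<close> (\<open>locally_nilpotent_X\<close>). Applied to the conjugates of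
  \<open>\<delta> = c \<partial>\<^sub>y\<close> by an automorphism \<open>\<sigma>\<close> and by its inverse, this gives \<open>\<sigma> x = \<alpha> x + \<beta>\<close> and
  \<open>\<sigma> y = \<mu> y + b(x)\<close> (\<open>automorphism_form\<close>).

  \<^emph>\<open>Genericity.\<close> The relation \<open>c z = q\<close> and the normalisation of reduced pairs force \<open>\<beta> = 0\<close>,
  \<open>c dvd b\<close> and \<open>q(\<alpha> x, \<mu> y) = \<mu>^d q(x, y)\<close> (\<open>automorphism_relation\<close>). The two coefficients
  assumed to be nonzero then give \<open>\<mu>^d = 1\<close> and \<open>\<alpha> = 1\<close>.

  \<^emph>\<open>Simplicity.\<close> Let \<open>\<sigma>\<close> commute with a simple derivation \<open>D\<close>. If \<open>\<mu> \<noteq> 1\<close>, then \<open>\<sigma>\<close> fixes the curve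
  \<open>y = b/(1-\<mu>)\<close> pointwise. The elements all of whose iterates under \<open>D\<close> vanish on this curve form
  a proper \<open>D\<close>-stable ideal, which contains every \<open>\<sigma> f - f\<close>; so \<open>\<sigma>\<close> is the identity
  (\<open>fixed_curve_imp_id\<close>). If \<open>\<mu> = 1\<close> and \<open>b \<noteq> 0\<close>, then \<open>D x\<close> is invariant under the translation
  \<open>y \<mapsto> y + b\<close>, hence lies in \<open>\<Bbbk>[x]\<close>, and simplicity makes it a nonzero constant \<open>e\<close>. Now
  \<open>\<sigma> (D y) - D y = e b'\<close> forces \<open>D y = h y + g\<close> with \<open>h b = e b'\<close> for a polynomial \<open>h\<close>, which
  contradicts \<open>deg b \<ge> deg c \<ge> 2\<close> (\<open>translation_not_commuting\<close>). So \<open>b = 0\<close> and \<open>\<sigma>\<close> is the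
  identity.\<close>

unbundle fps_syntax

section \<open>Polynomials in \<open>x\<close> as Laurent series at infinity\<close>

lemma map_poly_add_hom:
  assumes "h 0 = 0" "\<And>a b. h (a + b) = h a + h b"
  shows "map_poly h (p + q) = map_poly h p + map_poly h q"
  by (rule poly_eqI) (simp add: coeff_map_poly assms)

lemma map_poly_mult_hom:
  fixes h :: "'a::comm_semiring_0 \<Rightarrow> 'b::comm_semiring_0"
  assumes "h 0 = 0" "\<And>a b. h (a + b) = h a + h b" "\<And>a b. h (a * b) = h a * h b"
  shows "map_poly h (p * q) = map_poly h p * map_poly h q"
proof (rule poly_eqI)
  fix i
  have "h (sum f A) = (\<Sum>k\<in>A. h (f k))" for f and A :: "nat set"
    by (induction A rule: infinite_finite_induct) (simp_all add: assms)
  then show "coeff (map_poly h (p * q)) i = coeff (map_poly h p * map_poly h q) i"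
    by (simp add: coeff_map_poly coeff_mult assms)
qed

text \<open>The series variable \<open>fls_X\<close> stands for \<open>1/x\<close>, so that the subdegree of a series is minus its
  degree in \<open>x\<close>.\<close>

definition emb :: "'a::field poly \<Rightarrow> 'a fls" where
  "emb p = poly (map_poly fls_const p) fls_X_inv"

lemma emb_0 [simp]: "emb 0 = 0"
  and emb_pCons: "emb (pCons a p) = fls_const a + fls_X_inv * emb p"
  by (simp_all add: emb_def map_poly_pCons)

lemma emb_const [simp]: "emb [:a:] = fls_const a"
  by (simp add: emb_pCons)

lemma emb_1 [simp]: "emb 1 = 1"
  by (simp add: one_pCons)

lemma emb_add: "emb (p + q) = emb p + emb q"
  unfolding emb_def by (subst map_poly_add_hom) (simp_all add: fls_plus_const)

lemma emb_mult: "emb (p * q) = emb p * emb q"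
  unfolding emb_def by (subst map_poly_mult_hom) (simp_all add: fls_plus_const)

lemma emb_minus: "emb (- p) = - emb p"
  using emb_add[of "- p" p] by (simp add: eq_neg_iff_add_eq_0)

lemma emb_diff: "emb (p - q) = emb p - emb q"
  using emb_add[of p "- q"] by (simp add: emb_minus)

lemma emb_nth: "emb p $$ i = (if i \<le> 0 then coeff p (nat (- i)) else 0)"
proof (induction p arbitrary: i)
  case (pCons a p)
  show ?case
    using pCons(2)[of "i + 1"] by (auto simp: emb_pCons fls_X_inv_times_conv_shift coeff_pCons
      nat_eq_iff split: nat.splits intro!: arg_cong[of _ _ "coeff p"])
qed simp

lemma emb_eq_0_iff [simp]: "emb p = 0 \<longleftrightarrow> p = 0"
proof
  assume "emb p = 0"
  then have "coeff p k = 0" for k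
    using emb_nth[of p "- int k"] by simp
  then show "p = 0" by (simp add: poly_eq_iff)
qed simp

lemma emb_eq_iff [simp]: "emb p = emb q \<longleftrightarrow> p = q"
  using emb_eq_0_iff[of "p - q"] by (simp add: emb_diff del: emb_eq_0_iff)

lemma fls_subdegree_emb: "fls_subdegree (emb p) = - int (degree p)"
proof (cases "p = 0")
  case False
  then show ?thesis
    by (intro fls_subdegree_eqI) (auto simp: emb_nth coeff_eq_0)
qed simp

abbreviation embY :: "'a::field poly poly \<Rightarrow> 'a fls poly" where
  "embY \<equiv> map_poly emb"

lemma embY_add: "embY (f + g) = embY f + embY g"
  by (rule map_poly_add_hom) (simp_all add: emb_add)

lemma embY_mult: "embY (f * g) = embY f * embY g"
  by (rule map_poly_mult_hom) (simp_all add: emb_add emb_mult)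

lemma embY_pCons: "embY (pCons p g) = pCons (emb p) (embY g)"
  by (simp add: map_poly_pCons)

lemma embY_smult: "embY (smult p g) = smult (emb p) (embY g)"
  by (simp add: map_poly_smult emb_mult)

lemma embY_minus: "embY (- g) = - embY g"
  by (rule poly_eqI) (simp add: coeff_map_poly emb_minus)

lemma coeff_embY: "coeff (embY g) i = emb (coeff g i)"
  by (simp add: coeff_map_poly)

lemma degree_embY: "degree (embY g) = degree g"
  by (cases "g = 0") (auto intro: map_poly_degree_eq)

lemma embY_eq_0_iff: "embY g = 0 \<longleftrightarrow> g = 0"
  by (auto simp: poly_eq_iff coeff_embY)

lemma embY_eq_iff: "embY f = embY g \<longleftrightarrow> f = g"
  by (auto simp: poly_eq_iff coeff_embY)

section \<open>The coordinate ring inside \<open>K[y]\<close>\<close>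

text \<open>What the argument uses of a reduced pair: \<open>q\<close> has constant leading coefficient \<open>l\<close> in \<open>y\<close>, and
  both \<open>c\<close> and \<open>q\<close> have no subleading term.\<close>

locale danielewski =
  fixes c :: "'a::field_char_0 poly" and q :: "'a poly poly" and n d :: nat and l :: 'a
  assumes n2: "n \<ge> 2" and d2: "d \<ge> 2"
    and degree_c: "degree c = n" and coeff_c: "coeff c (n - 1) = 0"
    and l: "l \<noteq> 0" and degree_q: "degree q = d" and coeff_q_top: "coeff q d = [:l:]"
    and coeff_q_sub: "coeff q (d - 1) = 0" and degree_coeff_q: "\<And>j. degree (coeff q j) < n"
begin

definition zz :: "'a fls poly" where
  "zz = smult (inverse (emb c)) (embY q)"

definition phi :: "'a poly poly poly \<Rightarrow> 'a fls poly" where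
  "phi F = poly (map_poly embY F) zz"

text \<open>The concrete copy of \<open>A\<close> in which all computations take place.\<close>

definition S :: "'a fls poly set" where
  "S = range phi"

abbreviation relator :: "'a poly poly poly" where
  "relator \<equiv> [:- q, [:c:]:]"

lemma c_nonzero: "c \<noteq> 0"
  using degree_c n2 by auto

lemma phi_0 [simp]: "phi 0 = 0"
  and phi_pCons: "phi (pCons g F) = embY g + zz * phi F"
  by (simp_all add: phi_def map_poly_pCons)

lemma phi_add: "phi (F + G) = phi F + phi G"
  unfolding phi_def by (subst map_poly_add_hom) (simp_all add: embY_add)

lemma phi_mult: "phi (F * G) = phi F * phi G"
  unfolding phi_def by (subst map_poly_mult_hom) (simp_all add: embY_add embY_mult)

lemma phi_const: "phi [:g:] = embY g"
  by (simp add: phi_pCons)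

lemma phi_1 [simp]: "phi 1 = 1"
  by (simp add: one_pCons phi_const map_poly_pCons)

lemma phi_minus: "phi (- F) = - phi F"
  using phi_add[of "- F" F] by (simp add: eq_neg_iff_add_eq_0)

lemma phi_diff: "phi (F - G) = phi F - phi G"
  using phi_add[of F "- G"] by (simp add: phi_minus)

lemma c_zz: "smult (emb c) zz = embY q"
  using c_nonzero by (simp add: zz_def)

lemma phi_r [simp]: "phi relator = 0"
  using c_zz by (simp add: phi_pCons embY_minus embY_pCons)

lemma S_add: "f \<in> S \<Longrightarrow> g \<in> S \<Longrightarrow> f + g \<in> S"
  and S_mult: "f \<in> S \<Longrightarrow> g \<in> S \<Longrightarrow> f * g \<in> S"
  and S_diff: "f \<in> S \<Longrightarrow> g \<in> S \<Longrightarrow> f - g \<in> S"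
  and S_minus: "f \<in> S \<Longrightarrow> - f \<in> S"
  by (auto simp: S_def image_iff simp flip: phi_add phi_mult phi_diff phi_minus)

lemma embY_in_S: "embY g \<in> S"
  by (metis S_def phi_const rangeI)

lemma zz_in_S: "zz \<in> S"
  using phi_pCons[of 0 1] by (metis S_def add_0 map_poly_0 mult.right_neutral phi_1 rangeI)

lemma emb_in_S: "[:emb p:] \<in> S"
  using embY_in_S[of "[:p:]"] by (simp add: map_poly_pCons)

lemma const_in_S: "[:fls_const a:] \<in> S"
  using emb_in_S[of "[:a:]"] by simp

lemma X_in_S: "[:fls_X_inv:] \<in> S"
  using emb_in_S[of "[:0, 1:]"] by (simp add: emb_pCons)

lemma Y_in_S: "[:0, 1:] \<in> S"
  using embY_in_S[of "[:0, 1:]"] by (simp add: map_poly_pCons)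

lemma zero_in_S: "0 \<in> S" and one_in_S: "1 \<in> S"
  using const_in_S[of 0] const_in_S[of 1] by (simp_all add: one_pCons)

text \<open>Two induction principles that express generation of \<open>\<Bbbk>[x,y]\<close> by \<open>x, y\<close> and of \<open>S\<close> by
  \<open>x, y, z\<close>: identities between derivations or homomorphisms are checked on generators.\<close>

lemma embY_induct [case_names const X Y add mult]:
  assumes "\<And>a. P [:fls_const a:]" "P [:fls_X_inv:]" "P [:0, 1:]"
    and "\<And>f g. f \<in> S \<Longrightarrow> g \<in> S \<Longrightarrow> P f \<Longrightarrow> P g \<Longrightarrow> P (f + g)"
    and "\<And>f g. f \<in> S \<Longrightarrow> g \<in> S \<Longrightarrow> P f \<Longrightarrow> P g \<Longrightarrow> P (f * g)"
  shows "P (embY g)"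
proof -
  have emb: "P [:emb p:]" for p
  proof (induction p)
    case 0
    show ?case using assms(1)[of 0] by simp
  next
    case (pCons a p)
    have "P ([:fls_const a:] + [:fls_X_inv:] * [:emb p:])"
      by (intro assms pCons S_mult const_in_S X_in_S emb_in_S)
    then show ?case by (simp add: emb_pCons mult.commute)
  qed
  show ?thesis
  proof (induction g)
    case 0
    show ?case using assms(1)[of 0] by simp
  next
    case (pCons p g)
    have "P ([:emb p:] + [:0, 1:] * embY g)"
      by (intro assms pCons emb S_mult emb_in_S Y_in_S embY_in_S)
    then show ?case by (simp add: embY_pCons)
  qed
qed

lemma S_induct [consumes 1, case_names const X Y Z add mult]:
  assumes "f \<in> S"
    and "\<And>a. P [:fls_const a:]" "P [:fls_X_inv:]" "P [:0, 1:]" "P zz"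
    and add: "\<And>f g. f \<in> S \<Longrightarrow> g \<in> S \<Longrightarrow> P f \<Longrightarrow> P g \<Longrightarrow> P (f + g)"
    and mult: "\<And>f g. f \<in> S \<Longrightarrow> g \<in> S \<Longrightarrow> P f \<Longrightarrow> P g \<Longrightarrow> P (f * g)"
  shows "P f"
proof -
  have embY: "P (embY g)" for g
    by (rule embY_induct) (use assms in auto)
  have "P (phi F)" for F
  proof (induction F)
    case 0
    show ?case using embY[of 0] by simp
  next
    case (pCons g F)
    then show ?case
      unfolding phi_pCons by (intro add mult embY S_mult embY_in_S zz_in_S assms(5))
        (auto simp: S_def)
  qed
  with assms(1) show ?thesis by (auto simp: S_def)
qed

text \<open>Since \<open>l\<close> is invertible, \<open>y^d\<close> can be eliminated by the relation, at the cost of a higher degree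
  in \<open>z\<close>. Normal forms \<open>\<Sum>\<^sub>k g\<^sub>k z^k\<close> are \<open>q\<close>-adic expansions: the \<open>y\<close>-degrees \<open>deg g\<^sub>k + d k\<close> of the
  summands are distinct, so that no cancellation of leading terms occurs.\<close>

definition normal_form :: "'a poly poly poly \<Rightarrow> bool" where
  "normal_form F \<longleftrightarrow> (\<forall>i. degree (coeff F i) < d)"

lemma normal_form_add: "normal_form F \<Longrightarrow> normal_form G \<Longrightarrow> normal_form (F + G)"
  by (auto simp: normal_form_def intro: degree_add_less)

lemma normal_form_pCons: "normal_form (pCons g F) \<longleftrightarrow> degree g < d \<and> normal_form F"
  unfolding normal_form_def by (auto simp: coeff_pCons all_conj_distrib split: nat.splits)

lemma normal_form_0: "normal_form 0"
  using d2 by (simp add: normal_form_def)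

lemma normal_form_mult_Y:
  assumes "normal_form F"
  shows "\<exists>F'. normal_form F' \<and> relator dvd smult [:0, 1:] F - F'"
  using assms
proof (induction F)
  case (pCons g F)
  then obtain F' where F': "normal_form F'" "relator dvd smult [:0, 1:] F - F'"
    by (auto simp: normal_form_pCons)
  \<comment> \<open>subtracting \<open>t q\<close> removes the term \<open>y^d\<close> from \<open>y g\<close>\<close>
  define t where "t = smult (inverse l) (coeff g (d - 1))"
  define g' where "g' = [:0, 1:] * g - smult t q"
  have g: "degree g < d" using pCons by (simp add: normal_form_pCons)
  have t: "t * [:l:] = coeff g (d - 1)"
    using l by (simp add: t_def mult.commute)
  have "degree g' < d"
  proof (rule degree_lessI)
    show "g' \<noteq> 0 \<or> 0 < d" using d2 by simp
    show "\<forall>k\<ge>d. coeff g' k = 0"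
    proof (intro allI impI)
      fix k assume "k \<ge> d"
      then show "coeff g' k = 0"
        using d2 g t coeff_q_top degree_q by (cases "k = d")
          (auto simp: g'_def coeff_pCons coeff_eq_0 split: nat.splits)
    qed
  qed
  then have "normal_form ([:g', [:t * c:]:] + pCons 0 F')"
    using F' d2 by (intro normal_form_add) (auto simp: normal_form_pCons normal_form_0)
  moreover have "smult [:0, 1:] (pCons g F) - ([:g', [:t * c:]:] + pCons 0 F') =
      relator * [:[:- t:]:] + [:0, 1:] * (smult [:0, 1:] F - F')"
    by (simp add: g'_def)
  then have "relator dvd smult [:0, 1:] (pCons g F) - ([:g', [:t * c:]:] + pCons 0 F')"
    using F'(2) by (metis dvd_add dvd_mult dvd_triv_left)
  ultimately show ?case by blast
qed (use normal_form_0 in auto)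

lemma ex_normal_form: "\<exists>F'. normal_form F' \<and> relator dvd F - F'"
proof -
  have 0: "\<exists>F'. normal_form F' \<and> relator dvd [:g:] - F'" for g
  proof (induction g)
    case (pCons a g)
    then obtain F' where F': "normal_form F'" "relator dvd [:g:] - F'" by blast
    obtain F'' where F'': "normal_form F''" "relator dvd smult [:0, 1:] F' - F''"
      using normal_form_mult_Y[OF F'(1)] by blast
    have "normal_form ([:[:a:]:] + F'')"
      using d2 F''(1) by (intro normal_form_add) (auto simp: normal_form_pCons normal_form_0)
    moreover have "[:pCons a g:] - ([:[:a:]:] + F'') =
        [:[:0, 1:]:] * ([:g:] - F') + (smult [:0, 1:] F' - F'')"
      by (simp add: smult_diff_right)
    then have "relator dvd [:pCons a g:] - ([:[:a:]:] + F'')"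
      using F'(2) F''(2) by (metis dvd_add dvd_mult)
    ultimately show ?case by blast
  qed (use normal_form_0 in auto)
  show ?thesis
  proof (induction F)
    case (pCons g F)
    then obtain F' where F': "normal_form F'" "relator dvd F - F'" by blast
    obtain F'' where F'': "normal_form F''" "relator dvd [:g:] - F''" using 0 by blast
    have "normal_form (F'' + pCons 0 F')"
      using d2 F' F'' by (intro normal_form_add) (auto simp: normal_form_pCons normal_form_0)
    moreover have "pCons g F - (F'' + pCons 0 F') = ([:g:] - F'') + [:0, 1:] * (F - F')"
      by (simp add: algebra_simps)
    then have "relator dvd pCons g F - (F'' + pCons 0 F')"
      using F'(2) F''(2) by (metis dvd_add dvd_mult)
    ultimately show ?case by blast
  qed (use normal_form_0 in auto)
qed

lemma degree_zz: "degree zz = d"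
  using c_nonzero degree_q by (simp add: zz_def degree_embY)

lemma lead_coeff_zz: "lead_coeff zz = fls_const l / emb c"
  unfolding degree_zz by (simp add: zz_def coeff_embY coeff_q_top field_simps)

lemma phi_normal_form:
  assumes "normal_form F" "F \<noteq> 0"
  shows "phi F \<noteq> 0 \<and> degree (phi F) = degree (lead_coeff F) + d * degree F \<and>
    lead_coeff (phi F) = emb (lead_coeff (lead_coeff F)) * (fls_const l / emb c) ^ degree F"
  using assms
proof (induction F)
  case (pCons g F)
  show ?case
  proof (cases "F = 0")
    case True
    then show ?thesis
      using pCons by (simp add: phi_pCons degree_embY embY_eq_0_iff coeff_embY)
  next
    case False
    have IH: "phi F \<noteq> 0" "degree (phi F) = degree (lead_coeff F) + d * degree F"
      "lead_coeff (phi F) = emb (lead_coeff (lead_coeff F)) * (fls_const l / emb c) ^ degree F"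
      using pCons False by (auto simp: normal_form_pCons)
    have zz: "zz \<noteq> 0" using degree_zz d2 by auto
    have deg: "degree (zz * phi F) = degree (lead_coeff F) + d * Suc (degree F)"
      using IH zz degree_zz by (simp add: degree_mult_eq)
    have "degree (embY g) < degree (zz * phi F)"
      using pCons unfolding deg by (simp add: normal_form_pCons degree_embY)
    then have "degree (phi (pCons g F)) = degree (zz * phi F)"
      "lead_coeff (phi (pCons g F)) = lead_coeff (zz * phi F)"
      unfolding phi_pCons by (simp_all add: degree_add_eq_right coeff_eq_0)
    moreover have "phi (pCons g F) \<noteq> 0"
      using calculation(1) deg d2 by auto
    moreover have "lead_coeff (phi (pCons g F)) =
        emb (lead_coeff (lead_coeff F)) * (fls_const l / emb c) ^ Suc (degree F)"
      unfolding calculation(2) lead_coeff_mult lead_coeff_zz IH(3) by simp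
    ultimately show ?thesis
      using False deg by simp
  qed
qed simp

lemma phi_eqI:
  assumes "relator dvd F - G"
  shows "phi F = phi G"
proof -
  from assms obtain H where "F - G = relator * H" by (elim dvdE)
  then have "phi F - phi G = phi relator * phi H" by (metis phi_diff phi_mult)
  then show ?thesis by (simp only: phi_r) simp
qed

lemma S_normal_form:
  assumes "f \<in> S"
  obtains F where "normal_form F" "f = phi F"
proof -
  from assms obtain G where G: "f = phi G" by (auto simp: S_def)
  obtain F where "normal_form F" "relator dvd G - F" using ex_normal_form by blast
  then have "phi G = phi F"
    by (intro phi_eqI)
  with G \<open>normal_form F\<close> that show ?thesis by blast
qed

text \<open>A nonzero normal form has a nonzero image, so the kernel of \<open>phi\<close> is the relation ideal.\<close>

lemma phi_eq_0_iff: "phi F = 0 \<longleftrightarrow> relator dvd F"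
proof
  assume F: "phi F = 0"
  obtain G where G: "normal_form G" "relator dvd F - G" using ex_normal_form by blast
  then have "phi G = 0"
    using F phi_eqI by metis
  then have "G = 0" using phi_normal_form G by blast
  with G show "relator dvd F" by simp
qed (use phi_eqI[of F 0] in simp)

text \<open>In the normal form with top term \<open>g z^m\<close>, \<open>m\<close> is the quotient of the \<open>y\<close>-degree by \<open>d\<close>, and
  \<open>z^m\<close> contributes \<open>(l/c)^m\<close> to the leading coefficient, that is, \<open>n m\<close> to its subdegree.\<close>

lemma S_pole_bound:
  assumes "f \<in> S" "f \<noteq> 0"
  shows "fls_subdegree (lead_coeff f) \<le> int n * int (degree f div d)"
proof -
  obtain F where F: "normal_form F" "f = phi F" using S_normal_form assms by blast
  then have "F \<noteq> 0" using assms by auto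
  note * = phi_normal_form[OF F(1) this]
  have "degree f div d = degree F"
    using * F d2 by (simp add: normal_form_def)
  moreover have lead: "lead_coeff f =
      emb (lead_coeff (lead_coeff F)) * (fls_const l / emb c) ^ degree F"
    using * F(2) by blast
  moreover have "emb (lead_coeff (lead_coeff F)) \<noteq> 0" "(fls_const l / emb c) ^ degree F \<noteq> 0"
    using \<open>F \<noteq> 0\<close> l c_nonzero by auto
  then have "fls_subdegree (lead_coeff f) =
      - int (degree (lead_coeff (lead_coeff F))) + int (degree F) * int n"
    unfolding lead using l c_nonzero
    by (simp add: fls_subdegree_pow fls_subdegree_emb fls_divide_subdegree degree_c)
  ultimately show ?thesis by simp
qed

lemma S_degree_less:
  assumes "f \<in> S" "degree f < d"
  obtains g where "f = embY g"
proof (cases "f = 0")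
  case False
  obtain F where F: "normal_form F" "f = phi F" using S_normal_form assms by blast
  then have "F \<noteq> 0" using False by auto
  then have "degree F = 0"
    using phi_normal_form[OF F(1)] F assms d2 by (cases "degree F") auto
  then obtain g where "F = [:g:]" by (metis degree_eq_zeroE)
  with F that show ?thesis by (simp add: phi_const)
qed (use that[of 0] in simp)

lemma S_degree_0:
  assumes "f \<in> S" "degree f = 0"
  obtains p where "f = [:emb p:]"
proof -
  have "degree f < d" using assms d2 by simp
  then obtain g where g: "f = embY g" using S_degree_less[OF assms(1)] by blast
  then have "degree g = 0" using assms by (simp add: degree_embY)
  then obtain p where "g = [:p:]" by (metis degree_eq_zeroE)
  with g that show ?thesis by (simp add: map_poly_pCons)
qed

lemma S_degree_le_1:
  assumes "f \<in> S" "degree f \<le> 1"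
  obtains b h where "f = [:emb b, emb h:]"
proof -
  have "degree f < d" using assms d2 by simp
  then obtain g where g: "f = embY g" using S_degree_less[OF assms(1)] by blast
  then have "degree g \<le> 1" using assms by (simp add: degree_embY)
  then have "g = [:coeff g 0, coeff g 1:]"
    by (auto simp: poly_eq_iff coeff_pCons coeff_eq_0 split: nat.splits)
  with g have "f = embY [:coeff g 0, coeff g 1:]" by simp
  with that show ?thesis by (simp add: map_poly_pCons)
qed

lemma S_degree_d:
  assumes "f \<in> S" "degree f \<le> d"
  obtains g h where "f = embY g + smult (emb h) zz" "degree g < d"
proof (cases "f = 0")
  case False
  obtain F where F: "normal_form F" "f = phi F" using S_normal_form assms by blast
  then have "F \<noteq> 0" using False by auto
  then have le: "degree (lead_coeff F) + d * degree F \<le> d"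
    using phi_normal_form[OF F(1)] F assms d2 by auto
  have "\<not> degree F \<ge> 2"
    using mult_le_mono2[of 2 "degree F" d] le d2 by linarith
  then have F1: "F = [:coeff F 0, coeff F 1:]"
    by (auto simp: poly_eq_iff coeff_pCons coeff_eq_0 split: nat.splits)
  have "degree (coeff F 1) = 0"
  proof (cases "degree F = 1")
    case True then show ?thesis using le by simp
  next
    case False
    then have "coeff F 1 = 0" using \<open>\<not> degree F \<ge> 2\<close> by (simp add: coeff_eq_0)
    then show ?thesis by simp
  qed
  then obtain h where "coeff F 1 = [:h:]" by (metis degree_eq_zeroE)
  then have "f = embY (coeff F 0) + smult (emb h) zz"
    using F F1 phi_pCons[of "coeff F 0" "[:[:h:]:]"] by (simp add: phi_const map_poly_pCons)
  moreover have "degree (coeff F 0) < d" using F by (simp add: normal_form_def)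
  ultimately show ?thesis by (rule that)
qed (use that[of 0 0] d2 in simp)

end

section \<open>Vector fields and their leading parts\<close>

text \<open>Differentiation with respect to \<open>x\<close>, written in the variable \<open>1/x\<close>.\<close>

definition laurent_dx :: "'a::field_char_0 fls \<Rightarrow> 'a fls" where
  "laurent_dx f = - (fls_X ^ 2 * fls_deriv f)"

lemma laurent_dx_nth: "laurent_dx f $$ i = of_int (1 - i) * f $$ (i - 1)"
  by (simp add: laurent_dx_def fls_X_power_times_conv_shift algebra_simps)

lemma laurent_dx_add: "laurent_dx (f + g) = laurent_dx f + laurent_dx g"
  and laurent_dx_mult: "laurent_dx (f * g) = laurent_dx f * g + f * laurent_dx g"
  and laurent_dx_const [simp]: "laurent_dx (fls_const a) = 0"
  by (simp_all add: laurent_dx_def algebra_simps)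

lemma laurent_dx_X_inv [simp]: "laurent_dx fls_X_inv = 1"
  by (rule fls_eqI) (simp add: laurent_dx_nth)

lemma laurent_dx_1 [simp]: "laurent_dx 1 = 0"
  using laurent_dx_const[of 1] by simp

lemma laurent_dx_0 [simp]: "laurent_dx 0 = 0"
  by (simp add: laurent_dx_def)

lemma laurent_dx_emb: "laurent_dx (emb p) = emb (pderiv p)"
  by (induction p)
    (simp_all add: emb_pCons laurent_dx_add laurent_dx_mult pderiv_pCons emb_add)

abbreviation poly_dx :: "'a::field_char_0 fls poly \<Rightarrow> 'a fls poly" where
  "poly_dx \<equiv> map_poly laurent_dx"

lemma poly_dx_add: "poly_dx (f + g) = poly_dx f + poly_dx g"
  by (rule map_poly_add_hom) (simp_all add: laurent_dx_add)

lemma poly_dx_mult: "poly_dx (f * g) = poly_dx f * g + f * poly_dx g"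
proof (rule poly_eqI)
  fix i
  have "laurent_dx (sum f A) = (\<Sum>k\<in>A. laurent_dx (f k))" for f :: "nat \<Rightarrow> 'a fls" and A
    by (induction A rule: infinite_finite_induct) (simp_all add: laurent_dx_add)
  then show "coeff (poly_dx (f * g)) i = coeff (poly_dx f * g + f * poly_dx g) i"
    by (simp add: coeff_map_poly coeff_mult laurent_dx_mult sum.distrib)
qed

definition vector_field :: "'a::field_char_0 fls poly \<Rightarrow> 'a fls poly \<Rightarrow> 'a fls poly \<Rightarrow> 'a fls poly" where
  "vector_field P R f = poly_dx f * P + pderiv f * R"

lemma vector_field_add: "vector_field P R (f + g) = vector_field P R f + vector_field P R g"
  and vector_field_mult:
    "vector_field P R (f * g) = vector_field P R f * g + f * vector_field P R g"
  by (simp_all add: vector_field_def poly_dx_add poly_dx_mult pderiv_add pderiv_mult algebra_simps)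

lemma vector_field_const [simp]: "vector_field P R [:fls_const a:] = 0"
  and vector_field_X [simp]: "vector_field P R [:fls_X_inv:] = P"
  and vector_field_Y [simp]: "vector_field P R [:0, 1:] = R"
  by (simp_all add: vector_field_def map_poly_pCons pderiv_pCons map_poly_1)

text \<open>In the order by \<open>y\<close>-degree first and \<open>x\<close>-degree second, no monomial of \<open>f\<close> exceeds
  \<open>x^k y^j\<close>; \<open>corner\<close> is the coefficient of that monomial, and it may vanish.\<close>

definition bounded_by :: "'a::field_char_0 fls poly \<Rightarrow> int \<Rightarrow> nat \<Rightarrow> bool" where
  "bounded_by f k j \<longleftrightarrow> degree f \<le> j \<and> (\<forall>i < - k. coeff f j $$ i = 0)"

definition corner :: "'a::field_char_0 fls poly \<Rightarrow> int \<Rightarrow> nat \<Rightarrow> 'a" where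
  "corner f k j = coeff f j $$ (- k)"

lemma fls_mult_nth_add:
  fixes a b :: "'a::field fls"
  assumes "\<forall>i<s. a $$ i = 0" "\<forall>i<t. b $$ i = 0"
  shows "\<forall>i<s+t. (a * b) $$ i = 0" "(a * b) $$ (s + t) = a $$ s * b $$ t"
proof -
  have "(\<forall>i<s+t. (a * b) $$ i = 0) \<and> (a * b) $$ (s + t) = a $$ s * b $$ t"
  proof (cases "a = 0 \<or> b = 0")
    case False
    then have le: "s \<le> fls_subdegree a" "t \<le> fls_subdegree b"
      using assms by (auto intro!: fls_subdegree_geI)
    show ?thesis
    proof (cases "s = fls_subdegree a \<and> t = fls_subdegree b")
      case True
      then show ?thesis by (auto simp: fls_times_nth_eq0)
    next
      case False
      with le have "s + t < fls_subdegree a + fls_subdegree b"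
        "s < fls_subdegree a \<or> t < fls_subdegree b" by auto
      then show ?thesis
        by (auto simp: fls_times_nth_eq0)
    qed
  qed auto
  then show "\<forall>i<s+t. (a * b) $$ i = 0" "(a * b) $$ (s + t) = a $$ s * b $$ t" by auto
qed

lemma coeff_mult_at_bound:
  assumes "degree f \<le> a" "degree g \<le> b"
  shows "coeff (f * g) (a + b) = coeff f a * coeff g b"
proof (cases "degree f = a \<and> degree g = b")
  case True
  then show ?thesis using coeff_mult_degree_sum[of f g] by simp
next
  case False
  with assms have "degree f < a \<or> degree g < b" by auto
  moreover have "degree (f * g) < a + b"
    using calculation assms degree_mult_le[of f g] by auto
  ultimately show ?thesis by (auto simp: coeff_eq_0)
qed

text \<open>The leading part of the vector field acts on leading monomials by
  \<open>x^k y^j \<mapsto> (k p + j r) x^(k+\<alpha>) y^(j+\<beta>)\<close>. The exponents of \<open>P\<close> and \<open>R\<close> are one ahead of the common shift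
  \<open>(\<alpha>, \<beta>)\<close> in \<open>x\<close> and in \<open>y\<close> respectively, which compensates for the differentiation.\<close>

lemma vector_field_corner:
  assumes f: "bounded_by f k j" and P: "bounded_by P (\<alpha> + 1) \<beta>" and R: "bounded_by R \<alpha> (Suc \<beta>)"
  shows "bounded_by (vector_field P R f) (k + \<alpha>) (j + \<beta>)"
    and "corner (vector_field P R f) (k + \<alpha>) (j + \<beta>) =
      (of_int k * corner P (\<alpha> + 1) \<beta> + of_nat j * corner R \<alpha> (Suc \<beta>)) * corner f k j"
proof -
  have deg: "degree f \<le> j" "degree P \<le> \<beta>" "degree R \<le> Suc \<beta>"
    using assms by (auto simp: bounded_by_def)
  have dx: "degree (poly_dx f) \<le> j"
    using deg map_poly_degree_leq[of laurent_dx f] by simp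
  have coeff1: "coeff (poly_dx f * P) (j + \<beta>) = laurent_dx (coeff f j) * coeff P \<beta>"
    using coeff_mult_at_bound[OF dx deg(2)] by (simp add: coeff_map_poly)
  have coeff2: "coeff (pderiv f * R) (j + \<beta>) = of_nat j * (coeff f j * coeff R (Suc \<beta>))"
  proof (cases j)
    case 0
    then have "pderiv f = 0" using deg by (simp add: pderiv_eq_0_iff)
    with 0 show ?thesis by simp
  next
    case (Suc i)
    then have "degree (pderiv f) \<le> i" using deg by (simp add: degree_pderiv)
    from coeff_mult_at_bound[OF this deg(3)] show ?thesis
      by (simp add: Suc coeff_pderiv mult.assoc)
  qed
  have coeff: "coeff (vector_field P R f) (j + \<beta>) =
      laurent_dx (coeff f j) * coeff P \<beta> + of_nat j * (coeff f j * coeff R (Suc \<beta>))"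
    by (simp add: vector_field_def coeff1 coeff2)
  have "degree (poly_dx f * P) \<le> j + \<beta>"
    using degree_mult_le[of "poly_dx f" P] dx deg by linarith
  moreover have "degree (pderiv f * R) \<le> j + \<beta>"
  proof (cases j)
    case 0
    then have "pderiv f = 0" using deg by (simp add: pderiv_eq_0_iff)
    then show ?thesis by simp
  next
    case (Suc i)
    then show ?thesis
      using degree_mult_le[of "pderiv f" R] deg by (simp add: degree_pderiv)
  qed
  ultimately have degree: "degree (vector_field P R f) \<le> j + \<beta>"
    unfolding vector_field_def by (rule degree_add_le)
  have low: "\<forall>i < - k. coeff f j $$ i = 0" "\<forall>i < - (\<alpha>+1). coeff P \<beta> $$ i = 0"
    "\<forall>i < - \<alpha>. coeff R (Suc \<beta>) $$ i = 0"
    using assms by (auto simp: bounded_by_def)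
  have low': "\<forall>i < - k+1. laurent_dx (coeff f j) $$ i = 0"
    using low(1) by (simp add: laurent_dx_nth)
  note 1 = fls_mult_nth_add[OF low' low(2)]
  note 2 = fls_mult_nth_add[OF low(1,3)]
  have eq: "- k + 1 + - (\<alpha> + 1) = - (k + \<alpha>)" "- k + - \<alpha> = - (k + \<alpha>)" by simp_all
  show "bounded_by (vector_field P R f) (k + \<alpha>) (j + \<beta>)"
    unfolding bounded_by_def coeff using degree 1(1) 2(1) unfolding eq by simp
  show "corner (vector_field P R f) (k + \<alpha>) (j + \<beta>) =
      (of_int k * corner P (\<alpha> + 1) \<beta> + of_nat j * corner R \<alpha> (Suc \<beta>)) * corner f k j"
    unfolding corner_def coeff using 1(2) 2(2) unfolding eq
    by (simp add: laurent_dx_nth algebra_simps)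
qed

lemma vector_field_corner_funpow:
  assumes f: "bounded_by f k j" and P: "bounded_by P (\<alpha> + 1) \<beta>" and R: "bounded_by R \<alpha> (Suc \<beta>)"
  shows "bounded_by ((vector_field P R ^^ N) f) (k + int N * \<alpha>) (j + N * \<beta>) \<and>
    corner ((vector_field P R ^^ N) f) (k + int N * \<alpha>) (j + N * \<beta>) =
      (\<Prod>s<N. of_int (k + int s * \<alpha>) * corner P (\<alpha> + 1) \<beta>
        + of_nat (j + s * \<beta>) * corner R \<alpha> (Suc \<beta>)) * corner f k j"
proof (induction N)
  case (Suc N)
  have eq: "k + int (Suc N) * \<alpha> = (k + int N * \<alpha>) + \<alpha>" "j + Suc N * \<beta> = (j + N * \<beta>) + \<beta>"
    by (simp_all add: algebra_simps)
  have "bounded_by ((vector_field P R ^^ N) f) (k + int N * \<alpha>) (j + N * \<beta>)"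
    using Suc by blast
  note vector_field_corner[OF this P R]
  then show ?case
    unfolding eq by (simp add: Suc mult.assoc mult.left_commute)
qed (use f in simp)

lemma nilpotent_corner:
  fixes P R :: "'a::field_char_0 fls poly"
  assumes f: "bounded_by f k j" "corner f k j \<noteq> 0"
    and P: "bounded_by P (\<alpha> + 1) \<beta>" and R: "bounded_by R \<alpha> (Suc \<beta>)"
    and "(vector_field P R ^^ N) f = 0"
  obtains s :: nat where
    "of_int (k + int s * \<alpha>) * corner P (\<alpha> + 1) \<beta> + of_nat (j + s * \<beta>) * corner R \<alpha> (Suc \<beta>) = 0"
proof -
  have "corner ((vector_field P R ^^ N) f) (k + int N * \<alpha>) (j + N * \<beta>) = 0"
    using assms(5) by (simp add: corner_def)
  with vector_field_corner_funpow[OF f(1) P R, of N] f(2) that show ?thesis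
    by (auto simp: prod_zero_iff)
qed

text \<open>The shift \<open>(\<alpha>, \<beta>)\<close> of a vector field is the larger of the shifts of its two components. If
  \<open>P = 0\<close>, the field could have shift \<open>\<beta> = -1\<close>, as \<open>\<partial>\<^sub>y\<close> does; for \<open>P \<noteq> 0\<close> the shift in \<open>y\<close> is
  a natural number.\<close>

lemma ex_common_bound:
  fixes P R :: "'a::field_char_0 fls poly"
  assumes "P \<noteq> 0"
  obtains \<alpha> \<beta> where "bounded_by P (\<alpha> + 1) \<beta>" "bounded_by R \<alpha> (Suc \<beta>)"
    "corner P (\<alpha> + 1) \<beta> \<noteq> 0 \<or> corner R \<alpha> (Suc \<beta>) \<noteq> 0"
proof -
  define \<beta> where "\<beta> = max (degree P) (degree R - 1)"
  define a where "a = coeff P \<beta>"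
  define b where "b = coeff R (Suc \<beta>)"
  have deg: "degree P \<le> \<beta>" "degree R \<le> Suc \<beta>" by (auto simp: \<beta>_def)
  have "a \<noteq> 0 \<or> b \<noteq> 0"
  proof (cases "degree P = \<beta>")
    case True
    then show ?thesis using assms by (auto simp: a_def)
  next
    case False
    then have "degree R = Suc \<beta>" by (auto simp: \<beta>_def max_def split: if_splits)
    then show ?thesis by (metis b_def degree_0 leading_coeff_0_iff nat.distinct(1))
  qed
  then obtain t :: int where t: "\<forall>i<t. a $$ (i - 1) = 0 \<and> b $$ i = 0" "a $$ (t - 1) \<noteq> 0 \<or> b $$ t \<noteq> 0"
  proof -
    define A where "A = fls_subdegree a + 1"
    define B where "B = fls_subdegree b"
    consider "a = 0" "b \<noteq> 0" | "b = 0" "a \<noteq> 0" | "a \<noteq> 0" "b \<noteq> 0"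
      using \<open>a \<noteq> 0 \<or> b \<noteq> 0\<close> by blast
    then show ?thesis
    proof cases
      case 1
      with that[of B] show ?thesis by (auto simp: B_def)
    next
      case 2
      with that[of A] show ?thesis by (auto simp: A_def)
    next
      case 3
      with that[of "min A B"] show ?thesis
        by (cases "A \<le> B") (auto simp: A_def B_def min_def)
    qed
  qed
  have eq: "a $$ i = 0" if "i < t - 1" for i
    using t(1)[rule_format, of "i + 1"] that by simp
  show ?thesis
  proof (rule that[of "- t" \<beta>])
    show "bounded_by P (- t + 1) \<beta>" "bounded_by R (- t) (Suc \<beta>)"
      using deg eq t(1) by (auto simp: bounded_by_def a_def b_def)
    show "corner P (- t + 1) \<beta> \<noteq> 0 \<or> corner R (- t) (Suc \<beta>) \<noteq> 0"
      using t(2) by (simp add: corner_def a_def b_def)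
  qed
qed

section \<open>Locally nilpotent derivations kill \<open>x\<close>\<close>

text \<open>The numerical contradiction. The weights \<open>s\<close>, \<open>t\<close> and \<open>d t - n s\<close> of \<open>x\<close>, \<open>y\<close>, \<open>z\<close> are
  the numbers of steps until the leading monomials of the generators are annihilated, and the
  shift has weight \<open>-1\<close>. Since \<open>t/s \<ge> n/d\<close>, this makes \<open>\<alpha> + n \<beta>/d\<close> negative. The pole bound for
  \<open>R\<close> prevents it unless \<open>d\<close> divides \<open>\<beta> + 1\<close>, and then the pole bound for \<open>P\<close> leaves only
  \<open>n (d - 1) < d\<close>.\<close>

lemma homogeneous_lnd_arith:
  fixes \<alpha> :: int and \<beta> n d s t :: nat
  assumes n: "n \<ge> 2" and d: "d \<ge> 2" and s: "s > 0"
    and weight: "int s * \<alpha> + int t * int \<beta> = -1" and z: "n * s \<le> d * t"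
    and P: "- (\<alpha> + 1) \<le> int n * int (\<beta> div d)" and R: "- \<alpha> \<le> int n * int (Suc \<beta> div d)"
  shows False
proof -
  have "int n * int s * int \<beta> \<le> int d * int t * int \<beta>"
    using z by (intro mult_right_mono) (simp_all flip: of_nat_mult)
  moreover have "int d * (int s * \<alpha>) + int d * (int t * int \<beta>) = - int d"
    using arg_cong[OF weight, of "\<lambda>x. int d * x"] by (simp add: algebra_simps)
  ultimately have "int s * (int d * \<alpha> + int n * int \<beta>) < 0"
    using d by (simp add: algebra_simps)
  then have lt: "int n * int \<beta> < int d * (- \<alpha>)"
    using s by (simp add: mult_less_0_iff)
  show False
  proof (cases "Suc (\<beta> mod d) = d")
    case True
    have "int d * (- (\<alpha> + 1)) \<le> int d * (int n * int (\<beta> div d))"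
      using P by (intro mult_left_mono) simp_all
    moreover have "int \<beta> = int d * int (\<beta> div d) + int d - 1"
    proof -
      have "Suc \<beta> = d * (\<beta> div d) + d"
        using True mult_div_mod_eq[of d \<beta>] by linarith
      then have "int (Suc \<beta>) = int (d * (\<beta> div d) + d)" by (simp only:)
      then show ?thesis by simp
    qed
    then have "int n * int \<beta> = int n * (int d * int (\<beta> div d) + int d - 1)"
      by (simp only:)
    ultimately have "int n * (int d - 1) < int d"
      using lt by (simp add: algebra_simps)
    moreover have "2 * (int d - 1) \<le> int n * (int d - 1)"
      using n d by (intro mult_right_mono) simp_all
    ultimately have "2 * (int d - 1) < int d" by (rule le_less_trans[rotated])
    moreover have "int d \<ge> 2" using d by simp
    ultimately show False by (simp add: algebra_simps)
  next
    case False
    then have "Suc \<beta> div d = \<beta> div d"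
      by (simp add: div_Suc mod_Suc)
    then have "int d * (- \<alpha>) \<le> int d * (int n * int (\<beta> div d))"
      using R by (intro mult_left_mono) simp_all
    also have "\<dots> = int n * int (d * (\<beta> div d))" by simp
    also have "\<dots> \<le> int n * int \<beta>"
      by (intro mult_left_mono) (simp_all only: of_nat_le_iff of_nat_0_le_iff, simp)
    finally show False using lt by simp
  qed
qed

lemma emb_of_nat: "emb (of_nat k) = of_nat k"
  by (induction k) (simp_all add: emb_add)

lemma pderiv_embY: "pderiv (embY g) = embY (pderiv g)"
  by (rule poly_eqI) (simp add: coeff_pderiv coeff_embY emb_mult emb_add emb_of_nat)

context danielewski
begin

definition derivation :: "('a fls poly \<Rightarrow> 'a fls poly) \<Rightarrow> bool" where
  "derivation E \<longleftrightarrow> (\<forall>f\<in>S. E f \<in> S) \<and> (\<forall>f\<in>S. \<forall>g\<in>S. E (f + g) = E f + E g) \<and>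
     (\<forall>f\<in>S. \<forall>g\<in>S. E (f * g) = E f * g + f * E g) \<and> (\<forall>a. E [:fls_const a:] = 0)"

definition locally_nilpotent :: "('a fls poly \<Rightarrow> 'a fls poly) \<Rightarrow> bool" where
  "locally_nilpotent E \<longleftrightarrow> derivation E \<and> (\<forall>f\<in>S. \<exists>N. (E ^^ N) f = 0)"

lemma derivation_closed: "derivation E \<Longrightarrow> f \<in> S \<Longrightarrow> E f \<in> S"
  and derivation_add: "derivation E \<Longrightarrow> f \<in> S \<Longrightarrow> g \<in> S \<Longrightarrow> E (f + g) = E f + E g"
  and derivation_mult: "derivation E \<Longrightarrow> f \<in> S \<Longrightarrow> g \<in> S \<Longrightarrow> E (f * g) = E f * g + f * E g"
  and derivation_const: "derivation E \<Longrightarrow> E [:fls_const a:] = 0"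
  by (auto simp: derivation_def)

text \<open>A derivation of \<open>S\<close> is determined by its values at \<open>x\<close> and \<open>y\<close>: differentiating \<open>c z = q\<close>
  determines the value at \<open>z\<close>, because \<open>c\<close> is not a zero divisor.\<close>

lemma derivation_eq_vector_field:
  assumes "derivation E" "f \<in> S"
  shows "E f = vector_field (E [:fls_X_inv:]) (E [:0, 1:]) f"
proof -
  let ?V = "vector_field (E [:fls_X_inv:]) (E [:0, 1:])"
  note E = derivation_add[OF assms(1)] derivation_mult[OF assms(1)] derivation_const[OF assms(1)]
  have embY: "E (embY g) = ?V (embY g)" for g
    by (rule embY_induct) (simp_all add: E vector_field_add vector_field_mult)
  have zz: "E zz = ?V zz"
  proof -
    have emb: "[:emb c:] = embY [:c:]" by (simp add: map_poly_pCons)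
    have "E ([:emb c:] * zz) = ?V ([:emb c:] * zz)"
      using embY[of q] c_zz by simp
    then have "[:emb c:] * E zz = [:emb c:] * ?V zz"
      using embY[of "[:c:]"]
      by (simp add: E(2)[OF emb_in_S zz_in_S] vector_field_mult flip: emb del: mult_pCons_left)
    moreover have "[:emb c:] \<noteq> 0" using c_nonzero by simp
    ultimately show ?thesis by (metis mult_left_cancel)
  qed
  show ?thesis
    using assms(2) by (induction rule: S_induct)
      (simp_all add: E vector_field_add vector_field_mult zz)
qed

lemma derivation_funpow:
  assumes "derivation E" "f \<in> S"
  shows "(E ^^ N) f = (vector_field (E [:fls_X_inv:]) (E [:0, 1:]) ^^ N) f \<and> (E ^^ N) f \<in> S"
proof (induction N)
  case (Suc N)
  then have in_S: "(E ^^ N) f \<in> S" by blast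
  show ?case
    using derivation_eq_vector_field[OF assms(1) in_S] derivation_closed[OF assms(1) in_S] Suc
    by (metis comp_apply funpow.simps(2))
qed (use assms in simp)

lemma bounded_by_zz: "bounded_by zz (- int n) d" "corner zz (- int n) d \<noteq> 0"
proof -
  have coeff: "coeff zz d = fls_const l / emb c"
    using lead_coeff_zz degree_zz by simp
  have sub: "fls_subdegree (coeff zz d) = int n"
    unfolding coeff using l c_nonzero
    by (simp add: fls_divide_subdegree fls_subdegree_emb degree_c)
  then show "bounded_by zz (- int n) d"
    by (simp add: bounded_by_def degree_zz)
  have "coeff zz d \<noteq> 0" unfolding coeff using l c_nonzero by simp
  then have "coeff zz d $$ fls_subdegree (coeff zz d) \<noteq> 0" by simp
  then show "corner zz (- int n) d \<noteq> 0"
    unfolding sub by (simp add: corner_def)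
qed

lemma corner_pole_bound:
  assumes "f \<in> S" "bounded_by f k j" "corner f k j \<noteq> 0"
  shows "- k \<le> int n * int (j div d)"
proof -
  have "coeff f j \<noteq> 0" using assms(3) by (auto simp: corner_def)
  then have deg: "degree f = j" "f \<noteq> 0"
    using assms(2) le_degree[of f j] by (auto simp: bounded_by_def)
  have "- k \<le> fls_subdegree (coeff f j)"
    using assms(2) \<open>coeff f j \<noteq> 0\<close> by (auto simp: bounded_by_def intro: fls_subdegree_geI)
  with S_pole_bound[OF assms(1) deg(2)] deg(1) show ?thesis by simp
qed

text \<open>In other words, \<open>\<Bbbk>[x]\<close> lies in the Makar-Limanov invariant of \<open>A\<close>. If the component \<open>P\<close> of the
  field were nonzero, then the orbits of the three generators would give the numbers to which
  \<open>homogeneous_lnd_arith\<close> applies.\<close>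

theorem locally_nilpotent_X:
  assumes "locally_nilpotent E"
  shows "E [:fls_X_inv:] = 0"
proof (rule ccontr)
  define P where "P = E [:fls_X_inv:]"
  define R where "R = E [:0, 1:]"
  assume "E [:fls_X_inv:] \<noteq> 0"
  then have "P \<noteq> 0" by (simp add: P_def)
  then obtain \<alpha> \<beta> where P: "bounded_by P (\<alpha> + 1) \<beta>" and R: "bounded_by R \<alpha> (Suc \<beta>)"
    and nonzero: "corner P (\<alpha> + 1) \<beta> \<noteq> 0 \<or> corner R \<alpha> (Suc \<beta>) \<noteq> 0"
    using ex_common_bound[of P R] by blast
  define p where "p = corner P (\<alpha> + 1) \<beta>"
  define r where "r = corner R \<alpha> (Suc \<beta>)"
  \<comment> \<open>The linear form \<open>k p + j r\<close> changes by \<open>w\<close> in each step along an orbit.\<close>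
  define w where "w = of_int \<alpha> * p + of_nat \<beta> * r"
  have der: "derivation E" using assms by (simp add: locally_nilpotent_def)
  have key: "\<exists>s::nat. of_int k * p + of_nat j * r = - of_nat s * w"
    if f: "f \<in> S" "bounded_by f k j" "corner f k j \<noteq> 0" for f k j
  proof -
    obtain N where "(E ^^ N) f = 0" using assms f(1) by (auto simp: locally_nilpotent_def)
    then have "(vector_field P R ^^ N) f = 0"
      using derivation_funpow[OF der f(1), of N] by (simp add: P_def R_def)
    from nilpotent_corner[OF f(2,3) P R this] obtain s :: nat where
      "of_int (k + int s * \<alpha>) * p + of_nat (j + s * \<beta>) * r = 0" by (auto simp: p_def r_def)
    then have "of_int k * p + of_nat j * r = - of_nat s * w"
      by (simp add: w_def algebra_simps eq_neg_iff_add_eq_0)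
    then show ?thesis by blast
  qed
  obtain s where s: "p = - of_nat s * w"
    using key[OF X_in_S, of 1 0] by (auto simp: bounded_by_def corner_def)
  obtain t where t: "r = - of_nat t * w"
    using key[OF Y_in_S, of 0 1] by (auto simp: bounded_by_def corner_def)
  obtain u where u: "- of_nat n * p + of_nat d * r = - of_nat u * w"
    using key[OF zz_in_S bounded_by_zz] by auto
  have w: "w \<noteq> 0" using nonzero s t by (auto simp: p_def r_def)
  have "w * (1 + of_int (int s * \<alpha> + int t * int \<beta>)) = 0"
    using w_def unfolding s t by (simp add: algebra_simps eq_neg_iff_add_eq_0)
  then have "(of_int (1 + (int s * \<alpha> + int t * int \<beta>)) :: 'a) = 0"
    using w by simp
  then have weight: "int s * \<alpha> + int t * int \<beta> = -1"
    unfolding of_int_eq_0_iff by simp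
  have "w * of_int (int n * int s - int d * int t + int u) = 0"
    using u unfolding s t by (simp add: algebra_simps)
  then have "int n * int s - int d * int t + int u = 0"
    using w by (simp only: mult_eq_0_iff of_int_eq_0_iff) simp
  then have z: "n * s \<le> d * t"
    by (simp flip: of_nat_mult)
  \<comment> \<open>Here \<open>\<beta> \<ge> 0\<close> enters, that is, the assumption \<open>P \<noteq> 0\<close>.\<close>
  have "s > 0"
  proof (rule ccontr)
    assume "\<not> s > 0"
    then have "int t * int \<beta> = -1" using weight by simp
    moreover have "int t * int \<beta> \<ge> 0" by simp
    ultimately show False by linarith
  qed
  then have "t > 0" using z n2 by (cases t) auto
  have "p \<noteq> 0" "r \<noteq> 0" using s t w \<open>s > 0\<close> \<open>t > 0\<close> by auto
  moreover have "P \<in> S" "R \<in> S"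
    using der X_in_S Y_in_S by (auto simp: P_def R_def derivation_def)
  ultimately have "- (\<alpha> + 1) \<le> int n * int (\<beta> div d)" "- \<alpha> \<le> int n * int (Suc \<beta> div d)"
    using corner_pole_bound[OF _ P] corner_pole_bound[OF _ R] by (simp_all add: p_def r_def)
  with homogeneous_lnd_arith[OF n2 d2 \<open>s > 0\<close> weight z] show False by blast
qed

text \<open>The field is now \<open>R \<partial>\<^sub>y\<close>; if \<open>R\<close> had positive degree in \<open>y\<close>, the iterates of \<open>y\<close> would never lose
  their positive degree.\<close>

lemma locally_nilpotent_Y:
  assumes "locally_nilpotent E"
  obtains g where "E [:0, 1:] = [:emb g:]"
proof -
  define R where "R = E [:0, 1:]"
  have der: "derivation E" using assms by (simp add: locally_nilpotent_def)
  have E: "E f = pderiv f * R" if "f \<in> S" for f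
    using derivation_eq_vector_field[OF der that] locally_nilpotent_X[OF assms]
    by (simp add: vector_field_def R_def)
  have "degree R = 0"
  proof (rule ccontr)
    assume R: "degree R \<noteq> 0"
    have "degree ((E ^^ N) [:0, 1:]) \<ge> 1 \<and> (E ^^ N) [:0, 1:] \<in> S" for N
    proof (induction N)
      case (Suc N)
      let ?f = "(E ^^ N) [:0, 1:]"
      have "pderiv ?f \<noteq> 0" "R \<noteq> 0"
        using Suc R by (auto simp: pderiv_eq_0_iff)
      then have "degree (pderiv ?f * R) \<ge> 1"
        using R by (simp add: degree_mult_eq)
      then show ?case
        using Suc E[of ?f] derivation_closed[OF der, of ?f] by simp
    qed (simp add: Y_in_S)
    moreover obtain N where "(E ^^ N) [:0, 1:] = 0"
      using assms Y_in_S by (auto simp: locally_nilpotent_def)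
    ultimately show False by (metis degree_0 not_one_le_zero)
  qed
  moreover have "R \<in> S" using der Y_in_S by (simp add: R_def derivation_def)
  ultimately obtain g where "R = [:emb g:]" using S_degree_0[of R] by blast
  with that show ?thesis by (simp add: R_def)
qed

text \<open>The standard locally nilpotent derivation \<open>c \<partial>\<^sub>y + q\<^sub>y \<partial>\<^sub>z\<close>; on \<open>K[y]\<close> it is just \<open>c \<partial>\<^sub>y\<close>.\<close>

definition delta :: "'a fls poly \<Rightarrow> 'a fls poly" where
  "delta f = smult (emb c) (pderiv f)"

lemma delta_zz: "delta zz = embY (pderiv q)"
  using c_zz by (simp add: delta_def pderiv_embY flip: pderiv_smult)

lemma delta_add: "delta (f + g) = delta f + delta g"
  and delta_mult: "delta (f * g) = delta f * g + f * delta g"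
  by (simp_all add: delta_def pderiv_add pderiv_mult smult_add_right algebra_simps)

lemma locally_nilpotent_delta: "locally_nilpotent delta"
proof -
  have "(delta ^^ N) f = 0" if "degree f < N" for N f
    using that
  proof (induction N arbitrary: f)
    case (Suc N)
    have "(delta ^^ N) (delta f) = 0"
    proof (cases "degree f = 0")
      case True
      then have "delta f = 0" by (simp add: delta_def pderiv_eq_0_iff)
      moreover have "(delta ^^ N) 0 = 0" by (induction N) (simp_all add: delta_def)
      ultimately show ?thesis by simp
    next
      case False
      then show ?thesis
        using Suc by (intro Suc) (simp add: delta_def degree_pderiv c_nonzero)
    qed
    then show ?case by (simp add: funpow_swap1)
  qed simp
  then have nilpotent: "\<exists>N. (delta ^^ N) f = 0" for f by blast
  have "delta f \<in> S" if "f \<in> S" for f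
    using that
  proof (induction rule: S_induct)
    case Y
    then show ?case using emb_in_S by (simp add: delta_def pderiv_pCons)
  qed (simp_all add: delta_add delta_mult S_add S_mult delta_zz embY_in_S,
       simp_all add: delta_def zero_in_S)
  moreover have "delta [:fls_const a:] = 0" for a by (simp add: delta_def)
  ultimately have "derivation delta"
    by (simp add: derivation_def delta_add delta_mult)
  then show ?thesis
    by (simp add: locally_nilpotent_def nilpotent)
qed

end

section \<open>The shape of the automorphisms\<close>

text \<open>The two top coefficients under an affine substitution. The subleading one detects the
  translation part; it is used for \<open>c\<close> in \<open>x\<close>, for \<open>q\<close> in \<open>y\<close>, and later for polynomials invariant
  under a translation of \<open>y\<close>.\<close>

lemma coeff_pcompose_affine:
  fixes f :: "'b::idom poly"
  assumes "degree f \<le> Suc m"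
  shows "coeff (pcompose f [:b, a:]) (Suc m) = a ^ Suc m * coeff f (Suc m)"
    and "coeff (pcompose f [:b, a:]) m =
      a ^ m * (coeff f m + of_nat (Suc m) * b * coeff f (Suc m))"
proof -
  have "coeff (pcompose f [:b, a:]) (Suc m) = a ^ Suc m * coeff f (Suc m) \<and>
    coeff (pcompose f [:b, a:]) m = a ^ m * (coeff f m + of_nat (Suc m) * b * coeff f (Suc m))"
    using assms
  proof (induction m arbitrary: f)
    case 0
    then have "f = [:coeff f 0, coeff f 1:]"
      by (auto simp: poly_eq_iff coeff_pCons coeff_eq_0 split: nat.splits)
    then obtain u v where "f = [:u, v:]" by blast
    then show ?case by (simp add: pcompose_pCons)
  next
    case (Suc m)
    obtain u g where f: "f = pCons u g" by (cases f)
    with Suc.prems have g: "degree g \<le> Suc m" by (auto simp: degree_pCons_eq_if split: if_splits)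
    note IH = Suc.IH[OF g]
    have "degree (pcompose g [:b, a:]) \<le> degree g * 1"
      by (rule order_trans[OF degree_pcompose_le]) simp
    then have "coeff (pcompose g [:b, a:]) (Suc (Suc m)) = 0"
      using g by (intro coeff_eq_0) linarith
    then show ?case
      unfolding f pcompose_pCons using IH by (simp add: algebra_simps)
  qed
  then show "coeff (pcompose f [:b, a:]) (Suc m) = a ^ Suc m * coeff f (Suc m)"
    "coeff (pcompose f [:b, a:]) m = a ^ m * (coeff f m + of_nat (Suc m) * b * coeff f (Suc m))"
    by blast+
qed

lemma dvd_coeff_pcompose_affine:
  fixes f :: "'b::idom poly"
  assumes "e dvd b"
  shows "e dvd coeff (pcompose f [:b, a:]) j - a ^ j * coeff f j"
proof (induction f arbitrary: j)
  case (pCons u g)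
  show ?case
  proof (cases j)
    case 0
    then show ?thesis using assms by (simp add: pcompose_pCons)
  next
    case (Suc k)
    have "coeff (pcompose (pCons u g) [:b, a:]) j - a ^ j * coeff (pCons u g) j =
        b * coeff (pcompose g [:b, a:]) j + a * (coeff (pcompose g [:b, a:]) k - a ^ k * coeff g k)"
      by (simp add: Suc pcompose_pCons algebra_simps)
    then show ?thesis using assms pCons by (simp add: dvd_add dvd_mult dvd_mult2)
  qed
qed simp

context danielewski
begin

text \<open>Consequences of \<open>\<sigma> c \<cdot> \<sigma> z = \<sigma> q\<close> in \<open>\<Bbbk>[x,y]\<close>, where \<open>\<sigma> z = g + h z\<close>. The coefficient of \<open>y^d\<close>
  makes \<open>h\<close> a constant and \<open>\<sigma> c\<close> a multiple of \<open>c\<close>, so the missing subleading term of \<open>c\<close> gives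
  \<open>\<beta> = 0\<close>; in the same way the missing subleading term of \<open>q\<close> gives \<open>c dvd b\<close>. Modulo \<open>c\<close> the
  relation then reads \<open>\<mu>^d q(x, y) = q(\<alpha> x, \<mu> y)\<close>, and this is an equality because the coefficients
  have smaller degree than \<open>c\<close>.\<close>

lemma twisted_relation:
  fixes \<alpha> \<beta> \<mu> :: 'a
  defines "p \<equiv> [:\<beta>, \<alpha>:]"
  assumes \<alpha>: "\<alpha> \<noteq> 0" and \<mu>: "\<mu> \<noteq> 0" and g: "degree g < d"
    and eq: "smult (pcompose c p) (smult c g + smult h q) =
      smult c (pcompose (map_poly (\<lambda>u. pcompose u p) q) [:b, [:\<mu>:]:])"
  shows "\<beta> = 0" and "c dvd b"
    and "\<And>i j. j < d \<Longrightarrow> \<alpha> ^ i * \<mu> ^ j * coeff (coeff q j) i = \<mu> ^ d * coeff (coeff q j) i"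
proof -
  define q' where "q' = map_poly (\<lambda>u. pcompose u p) q"
  define w where "w = pcompose q' [:b, [:\<mu>:]:]"
  obtain m where m: "d = Suc m" using d2 by (cases d) auto
  obtain k where k: "n = Suc k" using n2 by (cases n) auto
  have coeff_q': "coeff q' i = pcompose (coeff q i) p" for i
    by (simp add: q'_def coeff_map_poly)
  have "degree q' \<le> Suc m"
    unfolding q'_def using map_poly_degree_leq[of "\<lambda>u. pcompose u p" q] degree_q m by simp
  from coeff_pcompose_affine[OF this, of b "[:\<mu>:]"]
  have w_top: "coeff w d = smult (\<mu> ^ d * l) 1"
    and w_sub': "coeff w m = smult (\<mu> ^ m * l) (b * of_nat d)"
    using coeff_q_top coeff_q_sub
    by (simp_all add: w_def coeff_q' m poly_const_pow one_pCons algebra_simps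
        flip: of_nat_Suc of_nat_poly)
  have "b * of_nat d = smult (of_nat d) b" by (simp add: of_nat_poly)
  then have w_sub: "coeff w m = smult (\<mu> ^ m * of_nat d * l) b"
    unfolding w_sub' by (simp add: mult_ac)
  have eq': "smult (pcompose c p) (smult c g + smult h q) = smult c w"
    using eq by (simp add: w_def q'_def)
  have "pcompose c p * (h * [:l:]) = c * smult (\<mu> ^ d * l) 1"
    using arg_cong[OF eq', of "\<lambda>f. coeff f d"] g coeff_q_top w_top by (simp add: coeff_eq_0)
  then have "smult l (pcompose c p * h) = smult l (smult (\<mu> ^ d) c)"
    by (simp add: mult.commute)
  then have ch: "pcompose c p * h = smult (\<mu> ^ d) c"
    using l by (metis smult_cancel)
  have deg_cp: "degree (pcompose c p) = n"
    using \<alpha> by (simp add: degree_pcompose degree_c p_def)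
  have "h \<noteq> 0" using ch \<mu> c_nonzero by auto
  moreover have "pcompose c p \<noteq> 0" using deg_cp n2 by auto
  ultimately have "degree (pcompose c p) + degree h = degree c"
    using arg_cong[OF ch, of degree] \<mu> by (simp add: degree_mult_eq)
  then have "degree h = 0" using deg_cp degree_c by simp
  then obtain \<gamma> where h: "h = [:\<gamma>:]" by (metis degree_eq_zeroE)
  have \<gamma>: "\<gamma> \<noteq> 0" using \<open>h \<noteq> 0\<close> h by auto
  have c_top: "coeff c (Suc k) \<noteq> 0" using c_nonzero degree_c k by (metis leading_coeff_0_iff)
  have cp: "smult \<gamma> (pcompose c p) = smult (\<mu> ^ d) c"
    using ch h by simp
  have "degree c \<le> Suc k" using degree_c k by simp
  note cc = coeff_pcompose_affine[OF this, of \<beta> \<alpha>, folded p_def]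
  have "\<gamma> * (\<alpha> ^ k * (of_nat (Suc k) * \<beta> * coeff c (Suc k))) = 0"
    using arg_cong[OF cp, of "\<lambda>f. coeff f k"] cc(2) coeff_c k by simp
  then show \<beta>: "\<beta> = 0"
    using \<gamma> \<alpha> c_top by (simp del: of_nat_Suc)
  \<comment> \<open>the factor with \<open>c(\<alpha> x) = \<rho> c(x)\<close>\<close>
  define \<rho> where "\<rho> = \<mu> ^ d / \<gamma>"
  have \<rho>: "\<rho> \<noteq> 0" "\<rho> * \<gamma> = \<mu> ^ d" using \<mu> \<gamma> by (simp_all add: \<rho>_def)
  have "smult \<gamma> (pcompose c p) = smult \<gamma> (smult \<rho> c)" using cp \<rho> by (simp add: mult.commute)
  then have cp': "pcompose c p = smult \<rho> c" using \<gamma> by (metis smult_cancel)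
  have "smult c (smult [:\<rho>:] (smult c g + smult h q)) = smult c w"
    using eq' by (simp add: cp' mult.commute smult_add_right)
  then have w: "smult [:\<rho>:] (smult c g + smult h q) = w"
    using c_nonzero by (metis smult_cancel)
  have coeff_w: "coeff w j = smult \<rho> (c * coeff g j) + smult (\<mu> ^ d) (coeff q j)" for j
    using arg_cong[OF w, of "\<lambda>f. coeff f j"]
    by (simp add: h smult_add_right \<rho>(2)[symmetric] mult.commute)
  have "smult (\<mu> ^ m * of_nat d * l) b = smult \<rho> (c * coeff g m)"
    using coeff_w[of m] w_sub coeff_q_sub m by simp
  then have "c dvd smult (\<mu> ^ m * of_nat d * l) b"
    by (simp add: dvd_smult)
  then show b: "c dvd b"
    by (rule dvd_smult_cancel) (use \<mu> l d2 in simp)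
  fix i j assume "j < d"
  have "c dvd coeff w j - [:\<mu>:] ^ j * pcompose (coeff q j) p"
    unfolding w_def using dvd_coeff_pcompose_affine[OF b, of q' "[:\<mu>:]" j] by (simp add: coeff_q')
  then have "c dvd smult (\<mu> ^ d) (coeff q j) - smult (\<mu> ^ j) (pcompose (coeff q j) p) + c * smult \<rho> (coeff g j)"
    by (simp add: coeff_w poly_const_pow algebra_simps)
  then have "c dvd smult (\<mu> ^ d) (coeff q j) - smult (\<mu> ^ j) (pcompose (coeff q j) p)"
    by (metis dvd_add_left_iff dvd_triv_left)
  moreover have "degree (smult (\<mu> ^ d) (coeff q j) - smult (\<mu> ^ j) (pcompose (coeff q j) p)) < degree c"
  proof (rule degree_diff_less)
    show "degree (smult (\<mu> ^ d) (coeff q j)) < degree c"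
      using degree_coeff_q degree_c n2 by simp
    show "degree (smult (\<mu> ^ j) (pcompose (coeff q j) p)) < degree c"
      using degree_coeff_q[of j] degree_c n2 \<alpha> by (simp add: degree_pcompose p_def)
  qed
  ultimately have "smult (\<mu> ^ d) (coeff q j) = smult (\<mu> ^ j) (pcompose (coeff q j) p)"
    using dvd_imp_degree_le leD by (metis eq_iff_diff_eq_0)
  from arg_cong[OF this, of "\<lambda>f. coeff f i"]
  show "\<alpha> ^ i * \<mu> ^ j * coeff (coeff q j) i = \<mu> ^ d * coeff (coeff q j) i"
    by (auto simp: p_def \<beta> coeff_pcompose_linear mult.commute)
qed

definition algebra_hom :: "('a fls poly \<Rightarrow> 'a fls poly) \<Rightarrow> bool" where
  "algebra_hom \<sigma> \<longleftrightarrow> (\<forall>f\<in>S. \<forall>g\<in>S. \<sigma> (f + g) = \<sigma> f + \<sigma> g) \<and>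
     (\<forall>f\<in>S. \<forall>g\<in>S. \<sigma> (f * g) = \<sigma> f * \<sigma> g) \<and> (\<forall>a. \<sigma> [:fls_const a:] = [:fls_const a:])"

lemma algebra_hom_add: "algebra_hom \<sigma> \<Longrightarrow> f \<in> S \<Longrightarrow> g \<in> S \<Longrightarrow> \<sigma> (f + g) = \<sigma> f + \<sigma> g"
  and algebra_hom_mult: "algebra_hom \<sigma> \<Longrightarrow> f \<in> S \<Longrightarrow> g \<in> S \<Longrightarrow> \<sigma> (f * g) = \<sigma> f * \<sigma> g"
  and algebra_hom_const: "algebra_hom \<sigma> \<Longrightarrow> \<sigma> [:fls_const a:] = [:fls_const a:]"
  by (auto simp: algebra_hom_def)

lemma algebra_hom_0: "algebra_hom \<sigma> \<Longrightarrow> \<sigma> 0 = 0"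
  using algebra_hom_const[of \<sigma> 0] by simp

lemma algebra_hom_unique:
  assumes \<sigma>: "algebra_hom \<sigma>" and \<tau>: "algebra_hom \<tau>"
    and X: "\<sigma> [:fls_X_inv:] = \<tau> [:fls_X_inv:]" and Y: "\<sigma> [:0, 1:] = \<tau> [:0, 1:]"
  shows "\<sigma> (embY g) = \<tau> (embY g)"
    and "\<sigma> [:emb c:] \<noteq> 0 \<Longrightarrow> f \<in> S \<Longrightarrow> \<sigma> f = \<tau> f"
proof -
  note hom = algebra_hom_add[OF \<sigma>] algebra_hom_add[OF \<tau>] algebra_hom_mult[OF \<sigma>]
    algebra_hom_mult[OF \<tau>] algebra_hom_const[OF \<sigma>] algebra_hom_const[OF \<tau>]
  show eq: "\<sigma> (embY g) = \<tau> (embY g)" for g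
    by (rule embY_induct) (simp_all add: hom X Y)
  assume nz: "\<sigma> [:emb c:] \<noteq> 0" and "f \<in> S"
  have "\<sigma> ([:emb c:] * zz) = \<tau> ([:emb c:] * zz)"
    using eq[of q] c_zz by simp
  moreover have "\<sigma> [:emb c:] = \<tau> [:emb c:]"
    using eq[of "[:c:]"] by (simp add: map_poly_pCons)
  ultimately have "\<sigma> [:emb c:] * \<sigma> zz = \<sigma> [:emb c:] * \<tau> zz"
    by (simp add: hom(3,4)[OF emb_in_S zz_in_S] del: mult_pCons_left)
  then have zz: "\<sigma> zz = \<tau> zz" using nz by (metis mult_left_cancel)
  show "\<sigma> f = \<tau> f"
    using \<open>f \<in> S\<close> by (induction rule: S_induct) (simp_all add: hom X Y zz)
qed

definition inverse_automorphisms ::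
  "('a fls poly \<Rightarrow> 'a fls poly) \<Rightarrow> ('a fls poly \<Rightarrow> 'a fls poly) \<Rightarrow> bool" where
  "inverse_automorphisms \<sigma> \<tau> \<longleftrightarrow> algebra_hom \<sigma> \<and> algebra_hom \<tau> \<and>
     (\<forall>f\<in>S. \<sigma> f \<in> S \<and> \<tau> f \<in> S \<and> \<sigma> (\<tau> f) = f \<and> \<tau> (\<sigma> f) = f)"

lemma inverse_automorphisms_sym: "inverse_automorphisms \<sigma> \<tau> \<Longrightarrow> inverse_automorphisms \<tau> \<sigma>"
  by (auto simp: inverse_automorphisms_def)

lemma locally_nilpotent_conjugate:
  assumes "locally_nilpotent E" "inverse_automorphisms \<sigma> \<tau>"
  shows "locally_nilpotent (\<lambda>f. \<tau> (E (\<sigma> f)))"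
proof -
  have E: "derivation E" using assms by (simp add: locally_nilpotent_def)
  have \<sigma>: "algebra_hom \<sigma>" and \<tau>: "algebra_hom \<tau>"
    using assms by (auto simp: inverse_automorphisms_def)
  have in_S: "\<sigma> f \<in> S" "\<tau> f \<in> S" "\<sigma> (\<tau> f) = f" "\<tau> (\<sigma> f) = f" if "f \<in> S" for f
    using assms that by (auto simp: inverse_automorphisms_def)
  note hom = algebra_hom_add[OF \<sigma>] algebra_hom_add[OF \<tau>] algebra_hom_mult[OF \<sigma>]
    algebra_hom_mult[OF \<tau>] algebra_hom_const[OF \<sigma>] algebra_hom_0[OF \<tau>]
    derivation_closed[OF E] derivation_add[OF E] derivation_mult[OF E] derivation_const[OF E]
  have "derivation (\<lambda>f. \<tau> (E (\<sigma> f)))"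
    by (simp add: derivation_def hom in_S S_mult)
  moreover have "\<exists>N. ((\<lambda>f. \<tau> (E (\<sigma> f))) ^^ N) f = 0" if f: "f \<in> S" for f
  proof -
    have "((\<lambda>f. \<tau> (E (\<sigma> f))) ^^ N) f = \<tau> ((E ^^ N) (\<sigma> f)) \<and> (E ^^ N) (\<sigma> f) \<in> S" for N
      by (induction N) (simp_all add: f in_S hom)
    moreover obtain N where "(E ^^ N) (\<sigma> f) = 0"
      using assms(1) in_S(1)[OF f] by (auto simp: locally_nilpotent_def)
    ultimately show ?thesis by (metis hom(6))
  qed
  ultimately show ?thesis by (simp add: locally_nilpotent_def)
qed

lemma automorphism_emb:
  assumes "algebra_hom \<sigma>" "\<sigma> [:fls_X_inv:] = [:emb p:]"
  shows "\<sigma> [:emb g:] = [:emb (pcompose g p):]"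
proof (induction g)
  case (pCons a g)
  have "\<sigma> ([:fls_const a:] + [:fls_X_inv:] * [:emb g:]) = [:emb (pcompose (pCons a g) p):]"
    unfolding algebra_hom_add[OF assms(1) const_in_S S_mult[OF X_in_S emb_in_S]]
      algebra_hom_mult[OF assms(1) X_in_S emb_in_S] assms(2) pCons algebra_hom_const[OF assms(1)]
    by (simp add: pcompose_pCons emb_add emb_mult)
  then show ?case by (simp add: emb_pCons mult.commute)
qed (use assms algebra_hom_0 in simp)

text \<open>Let \<open>E = \<tau> \<delta> \<sigma>\<close>, which is locally nilpotent. \<open>E x = 0\<close> means that \<open>\<sigma> x\<close> lies in the kernel of
  \<open>\<delta>\<close>, and \<open>E y \<in> \<Bbbk>[x]\<close> means that \<open>\<delta>\<close> maps \<open>\<sigma> y\<close> into \<open>\<sigma> (\<Bbbk>[x]) \<subseteq> \<Bbbk>[x]\<close>.\<close>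

lemma automorphism_X_Y:
  assumes "inverse_automorphisms \<sigma> \<tau>"
  obtains p b h where "\<sigma> [:fls_X_inv:] = [:emb p:]" "\<sigma> [:0, 1:] = [:emb b, emb h:]"
proof -
  define E where "E = (\<lambda>f. \<tau> (delta (\<sigma> f)))"
  have E: "locally_nilpotent E"
    unfolding E_def by (rule locally_nilpotent_conjugate[OF locally_nilpotent_delta assms])
  have in_S: "\<sigma> f \<in> S" "\<tau> f \<in> S" "\<sigma> (\<tau> f) = f" "\<tau> (\<sigma> f) = f" if "f \<in> S" for f
    using assms that by (auto simp: inverse_automorphisms_def)
  have \<sigma>: "algebra_hom \<sigma>" using assms by (simp add: inverse_automorphisms_def)
  have "derivation delta" using locally_nilpotent_delta by (simp add: locally_nilpotent_def)
  then have \<sigma>E: "\<sigma> (E f) = delta (\<sigma> f)" if "f \<in> S" for f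
    using that by (simp add: E_def in_S derivation_closed)
  have "delta (\<sigma> [:fls_X_inv:]) = 0"
    using \<sigma>E[OF X_in_S] locally_nilpotent_X[OF E] algebra_hom_0[OF \<sigma>] by simp
  then have "degree (\<sigma> [:fls_X_inv:]) = 0"
    using c_nonzero by (simp add: delta_def pderiv_eq_0_iff)
  then obtain p where p: "\<sigma> [:fls_X_inv:] = [:emb p:]"
    using S_degree_0[OF in_S(1)[OF X_in_S]] by blast
  obtain g where "E [:0, 1:] = [:emb g:]" using locally_nilpotent_Y[OF E] .
  then have "delta (\<sigma> [:0, 1:]) = [:emb (pcompose g p):]"
    using \<sigma>E[OF Y_in_S] automorphism_emb[OF \<sigma> p] by simp
  then have "degree (delta (\<sigma> [:0, 1:])) = 0" by simp
  then have "degree (\<sigma> [:0, 1:]) \<le> 1"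
    using c_nonzero by (simp add: delta_def degree_pderiv)
  then obtain b h where "\<sigma> [:0, 1:] = [:emb b, emb h:]"
    using S_degree_le_1[OF in_S(1)[OF Y_in_S]] by blast
  with p that show ?thesis by blast
qed

text \<open>The inverse has the form of \<open>automorphism_X_Y\<close> as well, so \<open>p\<close> is invertible under composition
  and \<open>h\<close> under multiplication.\<close>

theorem automorphism_form:
  assumes "inverse_automorphisms \<sigma> \<tau>"
  obtains \<alpha> \<beta> \<mu> b where "\<alpha> \<noteq> 0" "\<mu> \<noteq> 0" "\<sigma> [:fls_X_inv:] = [:emb [:\<beta>, \<alpha>:]:]"
    "\<sigma> [:0, 1:] = [:emb b, fls_const \<mu>:]"
proof -
  obtain p b h where \<sigma>X: "\<sigma> [:fls_X_inv:] = [:emb p:]" and \<sigma>Y: "\<sigma> [:0, 1:] = [:emb b, emb h:]"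
    using automorphism_X_Y[OF assms] .
  obtain p' b' h' where \<tau>X: "\<tau> [:fls_X_inv:] = [:emb p':]"
    and \<tau>Y: "\<tau> [:0, 1:] = [:emb b', emb h':]"
    using automorphism_X_Y[OF inverse_automorphisms_sym[OF assms]] .
  have \<sigma>: "algebra_hom \<sigma>" using assms by (simp add: inverse_automorphisms_def)
  have inv: "\<sigma> (\<tau> f) = f" if "f \<in> S" for f
    using assms that by (auto simp: inverse_automorphisms_def)
  have "[:emb (pcompose p' p):] = [:fls_X_inv:]"
    using inv[OF X_in_S] \<tau>X automorphism_emb[OF \<sigma> \<sigma>X] by simp
  then have "emb (pcompose p' p) = emb [:0, 1:]" by (simp add: emb_pCons)
  then have "pcompose p' p = [:0, 1:]" by (simp only: emb_eq_iff)
  then have "degree p' * degree p = 1" by (metis degree_pcompose degree_pCons_eq_if one_neq_zero degree_0 One_nat_def pCons_eq_0_iff)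
  then have deg_p: "degree p = 1" by simp
  have "[:0, 1:] = \<sigma> ([:emb b':] + [:emb h':] * [:0, 1:])"
    using inv[OF Y_in_S] \<tau>Y by simp
  also have "\<dots> = [:emb (pcompose b' p):] + [:emb (pcompose h' p):] * [:emb b, emb h:]"
    unfolding algebra_hom_add[OF \<sigma> emb_in_S S_mult[OF emb_in_S Y_in_S]]
      algebra_hom_mult[OF \<sigma> emb_in_S Y_in_S] automorphism_emb[OF \<sigma> \<sigma>X] \<sigma>Y ..
  finally have "emb (pcompose h' p * h) = emb 1" by (simp add: emb_mult mult.commute)
  then have "pcompose h' p * h = 1" by (simp only: emb_eq_iff)
  then have "h dvd 1" by (metis dvd_triv_right)
  then obtain \<mu> where \<mu>: "h = [:\<mu>:]" "\<mu> \<noteq> 0" by (auto simp: is_unit_poly_iff dvd_field_iff)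
  have "p = [:coeff p 0, coeff p 1:]"
    using deg_p by (auto simp: poly_eq_iff coeff_pCons coeff_eq_0 split: nat.splits)
  moreover have "coeff p 1 \<noteq> 0" using deg_p by (metis degree_0 leading_coeff_0_iff zero_neq_one)
  ultimately show ?thesis using that \<mu> \<sigma>X \<sigma>Y by (metis emb_const)
qed

lemma automorphism_relation:
  assumes \<sigma>\<tau>: "inverse_automorphisms \<sigma> \<tau>" and nonzero: "\<alpha> \<noteq> 0" "\<mu> \<noteq> 0"
    and \<sigma>X: "\<sigma> [:fls_X_inv:] = [:emb [:\<beta>, \<alpha>:]:]" and \<sigma>Y: "\<sigma> [:0, 1:] = [:emb b, fls_const \<mu>:]"
  shows "\<beta> = 0" and "c dvd b"
    and "\<And>i j. j < d \<Longrightarrow> \<alpha> ^ i * \<mu> ^ j * coeff (coeff q j) i = \<mu> ^ d * coeff (coeff q j) i"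
proof -
  define p where "p = [:\<beta>, \<alpha>:]"
  define w where "w g = pcompose (map_poly (\<lambda>u. pcompose u p) g) [:b, [:\<mu>:]:]" for g
  have \<sigma>: "algebra_hom \<sigma>" using \<sigma>\<tau> by (simp add: inverse_automorphisms_def)
  have \<sigma>emb: "\<sigma> [:emb g:] = [:emb (pcompose g p):]" for g
    using automorphism_emb[OF \<sigma>] \<sigma>X by (simp add: p_def)
  have \<sigma>embY: "\<sigma> (embY g) = embY (w g)" for g
  proof (induction g)
    case (pCons u g)
    have "\<sigma> ([:emb u:] + [:0, 1:] * embY g) = [:emb (pcompose u p):] + [:emb b, fls_const \<mu>:] * embY (w g)"
      unfolding algebra_hom_add[OF \<sigma> emb_in_S S_mult[OF Y_in_S embY_in_S]]
        algebra_hom_mult[OF \<sigma> Y_in_S embY_in_S] \<sigma>emb \<sigma>Y pCons ..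
    then show ?case
      by (simp add: w_def embY_pCons map_poly_pCons pcompose_pCons embY_add embY_mult embY_smult)
  qed (simp add: w_def algebra_hom_0[OF \<sigma>])
  have "\<sigma> ([:emb c:] * zz) = embY (w q)"
    using c_zz \<sigma>embY by simp
  then have rel: "[:emb (pcompose c p):] * \<sigma> zz = embY (w q)"
    unfolding algebra_hom_mult[OF \<sigma> emb_in_S zz_in_S] \<sigma>emb .
  have cp: "pcompose c p \<noteq> 0"
    using nonzero degree_c n2 by (auto simp: p_def pcompose_eq_0_iff)
  have "degree (w q) \<le> d"
  proof -
    have "degree (w q) \<le> degree (map_poly (\<lambda>u. pcompose u p) q) * 1"
      unfolding w_def by (rule order_trans[OF degree_pcompose_le]) (simp add: nonzero)
    also have "\<dots> \<le> d" using map_poly_degree_leq[of "\<lambda>u. pcompose u p" q] degree_q by simp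
    finally show ?thesis .
  qed
  moreover have "degree (\<sigma> zz) = degree (w q)"
    using arg_cong[OF rel, of degree] cp by (simp add: degree_embY)
  moreover have "\<sigma> zz \<in> S" using \<sigma>\<tau> zz_in_S by (simp add: inverse_automorphisms_def)
  ultimately obtain g h where gh: "\<sigma> zz = embY g + smult (emb h) zz" "degree g < d"
    using S_degree_d by metis
  have "smult (emb c) (\<sigma> zz) = embY (smult c g + smult h q)"
    unfolding gh embY_add embY_smult c_zz[symmetric] by (simp add: smult_add_right mult.commute)
  then have "embY (smult (pcompose c p) (smult c g + smult h q)) =
      smult (emb (pcompose c p)) (smult (emb c) (\<sigma> zz))"
    by (simp only: embY_smult)
  also have "\<dots> = smult (emb c) ([:emb (pcompose c p):] * \<sigma> zz)"
    by (simp add: mult.commute)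
  also have "\<dots> = embY (smult c (w q))" by (simp add: rel embY_smult del: mult_pCons_left)
  finally have "smult (pcompose c p) (smult c g + smult h q) = smult c (w q)"
    by (simp add: embY_eq_iff)
  from twisted_relation[OF nonzero gh(2), of \<beta> h b, folded p_def, OF this[unfolded w_def]]
  show "\<beta> = 0" "c dvd b"
    "\<And>i j. j < d \<Longrightarrow> \<alpha> ^ i * \<mu> ^ j * coeff (coeff q j) i = \<mu> ^ d * coeff (coeff q j) i"
    by auto
qed

end

section \<open>Automorphisms commuting with a simple derivation\<close>

context danielewski
begin

text \<open>\<open>S\<close> is a subset of \<open>K[y]\<close>, so its ideals are described by closure conditions.\<close>

definition simple :: "('a fls poly \<Rightarrow> 'a fls poly) \<Rightarrow> bool" where
  "simple D \<longleftrightarrow> derivation D \<and>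
     (\<forall>I\<subseteq>S. 0 \<in> I \<and> (\<forall>f\<in>I. \<forall>g\<in>I. f + g \<in> I) \<and> (\<forall>f\<in>I. \<forall>g\<in>S. f * g \<in> I) \<and>
        (\<forall>f\<in>I. D f \<in> I) \<longrightarrow> I = {0} \<or> I = S)"

lemma simpleD:
  assumes "simple D" "I \<subseteq> S" "0 \<in> I" "\<And>f g. f \<in> I \<Longrightarrow> g \<in> I \<Longrightarrow> f + g \<in> I"
    "\<And>f g. f \<in> I \<Longrightarrow> g \<in> S \<Longrightarrow> f * g \<in> I" "\<And>f. f \<in> I \<Longrightarrow> D f \<in> I"
  shows "I = {0} \<or> I = S"
proof -
  have "I \<subseteq> S \<longrightarrow> 0 \<in> I \<and> (\<forall>f\<in>I. \<forall>g\<in>I. f + g \<in> I) \<and>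
      (\<forall>f\<in>I. \<forall>g\<in>S. f * g \<in> I) \<and> (\<forall>f\<in>I. D f \<in> I) \<longrightarrow> I = {0} \<or> I = S"
    using assms(1) unfolding simple_def by (elim conjE allE)
  from mp[OF mp[OF this assms(2)]] show ?thesis
    using assms(3-6) by simp
qed

lemma derivation_diff:
  assumes "derivation D" "f \<in> S" "g \<in> S"
  shows "D (f - g) = D f - D g"
  using derivation_add[OF assms(1) S_diff[OF assms(2,3)] assms(3)] by simp

lemma funpow_derivation:
  assumes D: "derivation D"
  shows "f \<in> S \<Longrightarrow> (D ^^ k) f \<in> S"
    and "f \<in> S \<Longrightarrow> g \<in> S \<Longrightarrow> (D ^^ k) (f + g) = (D ^^ k) f + (D ^^ k) g"
    and "f \<in> S \<Longrightarrow> g \<in> S \<Longrightarrow> (D ^^ k) (f - g) = (D ^^ k) f - (D ^^ k) g"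
proof -
  show closed: "(D ^^ k) f \<in> S" if "f \<in> S" for f k
    using that by (induction k) (simp_all add: derivation_closed[OF D])
  show "(D ^^ k) (f + g) = (D ^^ k) f + (D ^^ k) g" if "f \<in> S" "g \<in> S"
    using that by (induction k) (simp_all add: derivation_add[OF D] closed)
  show "(D ^^ k) (f - g) = (D ^^ k) f - (D ^^ k) g" if "f \<in> S" "g \<in> S"
    using that by (induction k) (simp_all add: derivation_diff[OF D] closed)
qed

text \<open>Evaluation at \<open>y = e\<close> is a ring homomorphism to \<open>K\<close>; the largest \<open>D\<close>-stable ideal inside its
  kernel is proper, so it vanishes, and it contains \<open>\<sigma> f - f\<close> since \<open>D\<close> and \<open>\<sigma>\<close> commute.\<close>

lemma fixed_curve_imp_id:
  assumes D: "simple D" and \<sigma>: "\<And>f. f \<in> S \<Longrightarrow> \<sigma> f \<in> S"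
    and comm: "\<And>f. f \<in> S \<Longrightarrow> \<sigma> (D f) = D (\<sigma> f)"
    and fixed: "\<And>f. f \<in> S \<Longrightarrow> poly (\<sigma> f) e = poly f e" and f: "f \<in> S"
  shows "\<sigma> f = f"
proof -
  have der: "derivation D" using D by (simp add: simple_def)
  note fp = funpow_derivation[OF der]
  define J where "J = {f \<in> S. \<forall>k. poly ((D ^^ k) f) e = 0}"
  have DJ: "D f \<in> J" if "f \<in> J" for f
  proof -
    have "poly ((D ^^ k) (D f)) e = 0" for k
    proof -
      have "poly ((D ^^ Suc k) f) e = 0" using that unfolding J_def by blast
      then show ?thesis by (simp add: funpow_swap1)
    qed
    moreover have "D f \<in> S" using that der by (simp add: J_def derivation_closed)
    ultimately show ?thesis by (simp add: J_def)
  qed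
  have mult: "poly ((D ^^ k) (f * g)) e = 0" if "f \<in> J" "g \<in> S" for f g k
    using that
  proof (induction k arbitrary: f g)
    case 0
    then have "poly ((D ^^ 0) f) e = 0" unfolding J_def by blast
    then show ?case by simp
  next
    case (Suc k)
    have S: "f \<in> S" "D f \<in> S" "D g \<in> S"
      using Suc.prems der by (auto simp: J_def derivation_closed)
    have "(D ^^ Suc k) (f * g) = (D ^^ k) (D f * g + f * D g)"
      using derivation_mult[OF der S(1) Suc.prems(2)] by (simp add: funpow_swap1)
    also have "\<dots> = (D ^^ k) (D f * g) + (D ^^ k) (f * D g)"
      by (rule fp) (simp_all add: S Suc.prems S_mult)
    finally show ?case
      using Suc.IH[OF DJ[OF Suc.prems(1)] Suc.prems(2)] Suc.IH[OF Suc.prems(1) S(3)] by simp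
  qed
  have "J = {0} \<or> J = S"
  proof (rule simpleD[OF D])
    show "J \<subseteq> S" by (auto simp: J_def)
    have "(D ^^ k) 0 = 0" for k
      using fp(3)[of 0 0 k] zero_in_S by simp
    then show "0 \<in> J" by (simp add: J_def zero_in_S)
  qed (use DJ mult in \<open>auto simp: J_def fp S_add S_mult\<close>)
  moreover have "1 \<notin> J"
  proof
    assume "1 \<in> J"
    then have "poly ((D ^^ 0) 1) e = 0" unfolding J_def by blast
    then show False by simp
  qed
  ultimately have J: "J = {0}" using one_in_S by blast
  have \<sigma>_funpow: "(D ^^ k) (\<sigma> f) = \<sigma> ((D ^^ k) f)" for k
    by (induction k) (simp_all add: comm fp(1)[OF f])
  have "poly ((D ^^ k) (\<sigma> f - f)) e = 0" for k
    by (simp add: fp(3)[OF \<sigma>[OF f] f] \<sigma>_funpow fixed[OF fp(1)[OF f]])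
  then have "\<sigma> f - f \<in> J" by (simp add: J_def S_diff \<sigma> f)
  with J show ?thesis by simp
qed

lemma emb_unit:
  assumes "f \<in> S" "[:emb u:] * f = 1"
  shows "u dvd 1"
proof -
  have u: "u \<noteq> 0" using assms by auto
  have "degree ([:emb u:] * f) = degree f" using u by simp
  then have "degree f = 0" unfolding assms(2) by simp
  then obtain p where "f = [:emb p:]" using S_degree_0[OF assms(1)] by blast
  then have "emb (u * p) = emb 1" using assms(2) by (simp add: emb_mult one_pCons mult.commute)
  then have "u * p = 1" by (simp only: emb_eq_iff)
  then show ?thesis by (metis dvd_triv_left)
qed

text \<open>The hypothesis says that the principal ideal generated by \<open>u\<close> is \<open>D\<close>-stable, hence all
  of \<open>S\<close>; and an inverse of \<open>u\<close> in \<open>S\<close> has \<open>y\<close>-degree zero, so it lies in \<open>\<Bbbk>[x]\<close>.\<close>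

lemma simple_no_invariant_divisor:
  assumes D: "simple D" and u: "u \<noteq> 0" and g: "g \<in> S" "D [:emb u:] = [:emb u:] * g"
  shows "u dvd 1"
proof -
  have der: "derivation D" using D by (simp add: simple_def)
  define I where "I = (\<lambda>f. [:emb u:] * f) ` S"
  have "I = {0} \<or> I = S"
  proof (rule simpleD[OF D])
    show "I \<subseteq> S" unfolding I_def by (blast intro: S_mult emb_in_S)
    have "[:emb u:] * 0 \<in> I" unfolding I_def by (rule imageI, rule zero_in_S)
    then show "0 \<in> I" by simp
    show "f + h \<in> I" if fh: "f \<in> I" "h \<in> I" for f h
    proof -
      obtain f' h' where "f' \<in> S" "h' \<in> S" "f = [:emb u:] * f'" "h = [:emb u:] * h'"
        using fh by (auto simp: I_def)
      then have "f + h = [:emb u:] * (f' + h')" "f' + h' \<in> S"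
        by (simp_all only: distrib_left S_add)
      then show ?thesis unfolding I_def by blast
    qed
    show "f * h \<in> I" if fh: "f \<in> I" "h \<in> S" for f h
    proof -
      obtain f' where "f' \<in> S" "f = [:emb u:] * f'" using fh by (auto simp: I_def)
      then have "f * h = [:emb u:] * (f' * h)" "f' * h \<in> S"
        using fh by (simp_all only: mult.assoc S_mult)
      then show ?thesis unfolding I_def by blast
    qed
    show "D f \<in> I" if f: "f \<in> I" for f
    proof -
      obtain h where h: "h \<in> S" "f = [:emb u:] * h" using f by (auto simp: I_def)
      have "D f = [:emb u:] * (g * h + D h)"
        unfolding h(2) derivation_mult[OF der emb_in_S h(1)] g(2) by (simp only: distrib_left mult.assoc)
      moreover have "g * h + D h \<in> S"
        using g(1) h(1) der by (intro S_add S_mult) (auto simp: derivation_closed)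
      ultimately show ?thesis unfolding I_def by blast
    qed
  qed
  moreover have "[:emb u:] * 1 \<in> I" unfolding I_def by (rule imageI, rule one_in_S)
  then have "[:emb u:] \<in> I" by simp
  then have "I \<noteq> {0}" using u by auto
  ultimately have "1 \<in> I" using one_in_S by blast
  then obtain f where "f \<in> S" "[:emb u:] * f = 1" unfolding I_def by (metis imageE)
  then show ?thesis by (rule emb_unit)
qed

lemma translation_not_commuting:
  assumes D: "simple D" and b: "degree b \<ge> 2"
    and comm: "\<And>f. f \<in> S \<Longrightarrow> pcompose (D f) [:emb b, 1:] = D (pcompose f [:emb b, 1:])"
  shows False
proof -
  have der: "derivation D" using D by (simp add: simple_def)
  have b0: "b \<noteq> 0" using b by auto
  define P where "P = D [:fls_X_inv:]"
  define R where "R = D [:0, 1:]"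
  have in_S: "P \<in> S" "R \<in> S" by (simp_all add: P_def R_def derivation_closed[OF der] X_in_S Y_in_S)
  \<comment> \<open>In characteristic zero, the translation \<open>y \<mapsto> y + b\<close> changes a polynomial of degree \<open>m + 1\<close> by a
    polynomial of degree \<open>m\<close>.\<close>
  have sub: "of_nat (Suc m) * emb b * coeff f (Suc m) = coeff (pcompose f [:emb b, 1:]) m - coeff f m"
    if "degree f = Suc m" for f m
    using coeff_pcompose_affine(2)[of f m "emb b" 1] that by (simp add: algebra_simps)
  have "pcompose P [:emb b, 1:] = P"
    using comm[OF X_in_S] by (simp add: P_def)
  then have "degree P = 0"
    using sub[of P "degree P - 1"] b0 leading_coeff_0_iff[of P]
    by (cases "degree P") (auto simp del: of_nat_Suc)
  then obtain e where e: "P = [:emb e:]" using S_degree_0[OF in_S(1)] by blast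
  have D_emb: "D [:emb g:] = [:emb (pderiv g * e):]" for g
  proof -
    have "D [:emb g:] = vector_field P R [:emb g:]"
      using derivation_eq_vector_field[OF der emb_in_S] by (simp add: P_def R_def)
    also have "\<dots> = [:emb (pderiv g * e):]"
      by (simp add: vector_field_def map_poly_pCons laurent_dx_emb e emb_mult)
    finally show ?thesis .
  qed
  have "e \<noteq> 0"
  proof
    assume "e = 0"
    \<comment> \<open>Then \<open>D\<close> kills \<open>x\<close>, and the ideal generated by \<open>x\<close> is \<open>D\<close>-stable.\<close>
    then have "D [:emb [:0, 1:]:] = [:emb [:0, 1:]:] * 0"
      using D_emb[of "[:0, 1:]"] by simp
    from simple_no_invariant_divisor[OF D _ zero_in_S this] show False
      by (simp add: is_unit_poly_iff)
  qed
  have "D [:emb e:] = [:emb e:] * [:emb (pderiv e):]"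
    by (simp add: D_emb emb_mult mult.commute)
  from simple_no_invariant_divisor[OF D \<open>e \<noteq> 0\<close> emb_in_S this]
  have deg_e: "degree e = 0" by (auto simp: is_unit_poly_iff)
  have b': "pderiv b * e \<noteq> 0" "degree (pderiv b * e) = degree b - 1"
    using b \<open>e \<noteq> 0\<close> deg_e by (auto simp: pderiv_eq_0_iff degree_mult_eq degree_pderiv)
  have "[:emb b, 1:] = [:emb b:] + [:0, 1:]" by simp
  then have "D [:emb b, 1:] = [:emb (pderiv b * e):] + R"
    using derivation_add[OF der emb_in_S Y_in_S, of b] D_emb by (simp add: R_def)
  then have R: "pcompose R [:emb b, 1:] = [:emb (pderiv b * e):] + R"
    using comm[OF Y_in_S] by (simp add: R_def pcompose_pCons)
  have "degree R \<noteq> 0"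
  proof
    assume "degree R = 0"
    then obtain a where "R = [:a:]" by (metis degree_eq_zeroE)
    with R b' show False by simp
  qed
  then obtain m where m: "degree R = Suc m" by (cases "degree R") auto
  then have top: "coeff R (Suc m) \<noteq> 0" by (metis leading_coeff_0_iff degree_0 nat.distinct(1))
  have eq: "of_nat (Suc m) * emb b * coeff R (Suc m) = coeff [:emb (pderiv b * e):] m"
    using sub[OF m] R by simp
  then have "m = 0"
    using top b0 by (cases m) (auto simp del: of_nat_Suc)
  then have "degree R \<le> 1" using m by simp
  then obtain a h where "R = [:emb a, emb h:]" using S_degree_le_1[OF in_S(2)] by blast
  with eq top \<open>m = 0\<close> have "emb (b * h) = emb (pderiv b * e)" and "h \<noteq> 0"
    by (auto simp: emb_mult)
  then have "b * h = pderiv b * e" by (simp only: emb_eq_iff)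
  with b' have "degree (b * h) = degree b - 1" by simp
  with b0 \<open>h \<noteq> 0\<close> b show False by (simp add: degree_mult_eq)
qed

theorem commuting_automorphism_trivial:
  assumes D: "simple D" and \<sigma>\<tau>: "inverse_automorphisms \<sigma> \<tau>"
    and comm: "\<And>f. f \<in> S \<Longrightarrow> \<sigma> (D f) = D (\<sigma> f)"
    and q00: "coeff (coeff q 0) 0 \<noteq> 0" and q10: "coeff (coeff q 0) 1 \<noteq> 0"
    and f: "f \<in> S"
  shows "\<sigma> f = f"
proof -
  have \<sigma>: "algebra_hom \<sigma>" using \<sigma>\<tau> by (simp add: inverse_automorphisms_def)
  obtain \<alpha> \<beta> \<mu> b where nonzero: "\<alpha> \<noteq> 0" "\<mu> \<noteq> 0"
    and \<sigma>X: "\<sigma> [:fls_X_inv:] = [:emb [:\<beta>, \<alpha>:]:]" and \<sigma>Y: "\<sigma> [:0, 1:] = [:emb b, fls_const \<mu>:]"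
    using automorphism_form[OF \<sigma>\<tau>] .
  note rel = automorphism_relation[OF \<sigma>\<tau> nonzero \<sigma>X \<sigma>Y]
  have "\<mu> ^ d = 1" using rel(3)[of 0 0] q00 d2 by simp
  then have "\<alpha> = 1" using rel(3)[of 0 1] q10 d2 by simp
  \<comment> \<open>\<open>\<sigma>\<close> is now the substitution \<open>y \<mapsto> \<mu> y + b\<close>.\<close>
  define T where "T f = pcompose f [:emb b, fls_const \<mu>:]" for f
  have T: "algebra_hom T"
    by (simp add: algebra_hom_def T_def pcompose_add pcompose_mult)
  have X: "\<sigma> [:fls_X_inv:] = [:emb [:0, 1:]:]" using \<sigma>X rel(1) \<open>\<alpha> = 1\<close> by simp
  have "\<sigma> [:emb c:] \<noteq> 0"
    using automorphism_emb[OF \<sigma> X, of c] c_nonzero by simp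
  then have \<sigma>T: "\<sigma> f = T f" if "f \<in> S" for f
    using algebra_hom_unique(2)[OF \<sigma> T _ _ _ that] X \<sigma>Y
    by (simp add: T_def pcompose_pCons emb_pCons)
  have \<sigma>S: "\<sigma> f \<in> S" if "f \<in> S" for f
    using \<sigma>\<tau> that by (simp add: inverse_automorphisms_def)
  show ?thesis
  proof (cases "\<mu> = 1")
    case False
    \<comment> \<open>the solution of \<open>\<mu> e + b = e\<close>, which is the fixed curve\<close>
    define e where "e = emb b / (1 - fls_const \<mu>)"
    have "1 - fls_const \<mu> \<noteq> 0" using False by (metis fls_const_eq_1_iff right_minus_eq)
    then have "emb b + e * fls_const \<mu> = e"
      by (simp add: e_def divide_simps) (simp add: algebra_simps)
    then have "poly (\<sigma> f) e = poly f e" if "f \<in> S" for f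
      using \<sigma>T[OF that] by (simp add: T_def poly_pcompose)
    from fixed_curve_imp_id[OF D \<sigma>S comm this f] show ?thesis by simp
  next
    case True
    show ?thesis
    proof (cases "b = 0")
      case True
      then show ?thesis using \<sigma>T[OF f] \<open>\<mu> = 1\<close> by (simp add: T_def)
    next
      case False
      then have "degree b \<ge> 2"
        using dvd_imp_degree_le[OF rel(2)] degree_c n2 by simp
      moreover have "pcompose (D f) [:emb b, 1:] = D (pcompose f [:emb b, 1:])" if "f \<in> S" for f
        using comm[OF that] \<sigma>T[OF that] \<sigma>T[OF derivation_closed[OF _ that]] D \<open>\<mu> = 1\<close>
        by (simp add: T_def simple_def)
      ultimately show ?thesis using translation_not_commuting[OF D] by blast
    qed
  qed
qed

end

section \<open>Transfer to the quotient ring, and the open set\<close>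

context danielewski
begin

abbreviation A :: "'a poly poly poly set ring" where
  "A \<equiv> surface_algebra c q"

text \<open>\<open>phi\<close> is constant on residue classes; this is the induced isomorphism from \<open>A\<close> onto \<open>S\<close>.\<close>

definition model :: "'a poly poly poly set \<Rightarrow> 'a fls poly" where
  "model w = the_elem (phi ` w)"

lemma ring_hom_phi:
  "ring_hom_ring polynomial_ring_xyz (ring_of_type_algebra :: 'a fls poly ring) phi"
proof (rule ring_hom_ringI2)
  show "ring (polynomial_ring_xyz :: 'a poly poly poly ring)" "ring (ring_of_type_algebra :: 'a fls poly ring)"
    by (rule ring_from_type_algebra)+
  show "phi \<in> ring_hom polynomial_ring_xyz ring_of_type_algebra"
    by (rule ring_hom_memI) (simp_all add: ring_of_type_algebra_def phi_add phi_mult)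
qed

lemma kernel_phi:
  "a_kernel polynomial_ring_xyz (ring_of_type_algebra :: 'a fls poly ring) phi = relation_ideal c q"
  unfolding a_kernel_def' relation_ideal_def cgenideal_def
  by (auto simp: ring_of_type_algebra_def phi_eq_0_iff dvd_def mult.commute)

lemma model_ring_iso: "model \<in> ring_iso A ((ring_of_type_algebra :: 'a fls poly ring) \<lparr>carrier := S\<rparr>)"
  using ring_hom_ring.FactRing_iso_set_aux[OF ring_hom_phi]
  unfolding kernel_phi surface_algebra_def model_def[abs_def] S_def
  by (simp add: ring_of_type_algebra_def)

lemma model_bij: "bij_betw model (carrier A) S"
  using ring_iso_memE(5)[OF model_ring_iso] by simp

lemma model_in_S: "x \<in> carrier A \<Longrightarrow> model x \<in> S"
  using model_bij by (auto simp: bij_betw_def)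

lemma model_eq_iff: "x \<in> carrier A \<Longrightarrow> y \<in> carrier A \<Longrightarrow> model x = model y \<longleftrightarrow> x = y"
  using model_bij by (auto simp: bij_betw_def inj_on_def)

lemma model_add: "x \<in> carrier A \<Longrightarrow> y \<in> carrier A \<Longrightarrow> model (x \<oplus>\<^bsub>A\<^esub> y) = model x + model y"
  and model_mult: "x \<in> carrier A \<Longrightarrow> y \<in> carrier A \<Longrightarrow> model (x \<otimes>\<^bsub>A\<^esub> y) = model x * model y"
  using ring_iso_memE(2,3)[OF model_ring_iso] by (simp_all add: ring_of_type_algebra_def)

sublocale A: cring A
  by (rule cring_surface_algebra)

lemma model_zero: "model \<zero>\<^bsub>A\<^esub> = 0"
  using model_add[of "\<zero>\<^bsub>A\<^esub>" "\<zero>\<^bsub>A\<^esub>"] by simp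

lemma model_scalar: "model (scalar c q a) = [:fls_const a:]"
  unfolding model_def scalar_def kernel_phi[symmetric]
  by (subst ring_hom_ring.the_elem_simp[OF ring_hom_phi])
    (simp_all add: ring_of_type_algebra_def phi_const map_poly_pCons)

lemma scalar_in_carrier: "scalar c q a \<in> carrier A"
  unfolding scalar_def surface_algebra_def FactRing_def A_RCOSETS_defs a_r_coset_def r_coset_def
  by (auto simp: ring_of_type_algebra_def)

definition inv_model :: "'a fls poly \<Rightarrow> 'a poly poly poly set" where
  "inv_model = inv_into (carrier A) model"

lemma inv_model: "f \<in> S \<Longrightarrow> inv_model f \<in> carrier A" "f \<in> S \<Longrightarrow> model (inv_model f) = f"
  and inv_model_model: "x \<in> carrier A \<Longrightarrow> inv_model (model x) = x"
  using model_bij by (auto simp: bij_betw_def inv_model_def inv_into_into f_inv_into_f)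

lemma inv_model_eqI: "x \<in> carrier A \<Longrightarrow> model x = f \<Longrightarrow> inv_model f = x"
  using inv_model_model by blast

lemma inv_model_add: "f \<in> S \<Longrightarrow> g \<in> S \<Longrightarrow> inv_model (f + g) = inv_model f \<oplus>\<^bsub>A\<^esub> inv_model g"
  and inv_model_mult: "f \<in> S \<Longrightarrow> g \<in> S \<Longrightarrow> inv_model (f * g) = inv_model f \<otimes>\<^bsub>A\<^esub> inv_model g"
  and inv_model_const: "inv_model [:fls_const a:] = scalar c q a"
  by (rule inv_model_eqI; simp add: inv_model model_add model_mult model_scalar scalar_in_carrier)+

definition transport ::
  "('a poly poly poly set \<Rightarrow> 'a poly poly poly set) \<Rightarrow> 'a fls poly \<Rightarrow> 'a fls poly" where
  "transport \<psi> f = model (\<psi> (inv_model f))"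

lemma derivation_transport:
  assumes "D \<in> derivations c q"
  shows "derivation (transport D)"
proof -
  have D_closed: "D x \<in> carrier A" if "x \<in> carrier A" for x
    using assms that by (auto simp: derivations_def Let_def)
  have D_add: "D (x \<oplus>\<^bsub>A\<^esub> y) = D x \<oplus>\<^bsub>A\<^esub> D y"
    and D_mult: "D (x \<otimes>\<^bsub>A\<^esub> y) = (D x \<otimes>\<^bsub>A\<^esub> y) \<oplus>\<^bsub>A\<^esub> (x \<otimes>\<^bsub>A\<^esub> D y)"
    if "x \<in> carrier A" "y \<in> carrier A" for x y
    using assms that by (auto simp: derivations_def Let_def)
  have D_scalar: "D (scalar c q a \<otimes>\<^bsub>A\<^esub> x) = scalar c q a \<otimes>\<^bsub>A\<^esub> D x"
    if "x \<in> carrier A" for x a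
    using assms that by (auto simp: derivations_def Let_def)
  have closed: "transport D f \<in> S" if "f \<in> S" for f
    using that by (simp add: transport_def model_in_S D_closed inv_model)
  have add: "transport D (f + g) = transport D f + transport D g" if "f \<in> S" "g \<in> S" for f g
    using that by (simp add: transport_def inv_model_add D_add D_closed inv_model model_add)
  have mult: "transport D (f * g) = transport D f * g + f * transport D g" if "f \<in> S" "g \<in> S" for f g
    using that by (simp add: transport_def inv_model_mult D_mult D_closed inv_model model_add model_mult)
  have one: "transport D 1 = 0"
    using mult[OF one_in_S one_in_S] by simp
  have "transport D ([:fls_const a:] * 1) = [:fls_const a:] * transport D 1" for a
    unfolding transport_def inv_model_mult[OF const_in_S one_in_S] inv_model_const
    by (simp add: D_scalar D_closed inv_model one_in_S model_mult scalar_in_carrier model_scalar del: mult_pCons_left)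
  then have "transport D [:fls_const a:] = 0" for a
    by (simp add: one)
  then show ?thesis
    by (simp add: derivation_def closed add mult)
qed

lemma simple_transport:
  assumes "simple_derivation c q D"
  shows "simple (transport D)"
  unfolding simple_def
proof (intro conjI allI impI)
  have D: "D \<in> derivations c q"
    and ideals: "\<And>I. ideal I A \<Longrightarrow> D ` I \<subseteq> I \<Longrightarrow> I = {\<zero>\<^bsub>A\<^esub>} \<or> I = carrier A"
    using assms by (auto simp: simple_derivation_def Let_def)
  show der: "derivation (transport D)" by (rule derivation_transport[OF D])
  fix I
  assume I_sub: "I \<subseteq> S"
    and "0 \<in> I \<and> (\<forall>f\<in>I. \<forall>g\<in>I. f + g \<in> I) \<and> (\<forall>f\<in>I. \<forall>g\<in>S. f * g \<in> I) \<and> (\<forall>f\<in>I. transport D f \<in> I)"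
  then have I: "0 \<in> I" "\<And>f g. f \<in> I \<Longrightarrow> g \<in> I \<Longrightarrow> f + g \<in> I"
    "\<And>f g. f \<in> I \<Longrightarrow> g \<in> S \<Longrightarrow> f * g \<in> I" "\<And>f. f \<in> I \<Longrightarrow> transport D f \<in> I" by auto
  define J where "J = {x \<in> carrier A. model x \<in> I}"
  have I_J: "I = model ` J"
    using I_sub model_bij by (auto simp: J_def bij_betw_def)
  have "ideal J A"
  proof (rule idealI)
    show "ring A" by (rule A.ring_axioms)
    show "subgroup J (add_monoid A)"
    proof (rule A.add.subgroupI)
      show "J \<subseteq> carrier A" by (auto simp: J_def)
      show "J \<noteq> {}" using I(1) by (auto simp: J_def model_zero intro!: exI[of _ "\<zero>\<^bsub>A\<^esub>"])
      show "x \<oplus>\<^bsub>A\<^esub> y \<in> J" if "x \<in> J" "y \<in> J" for x y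
        using that I(2) by (simp add: J_def model_add)
      show "\<ominus>\<^bsub>A\<^esub> x \<in> J" if "x \<in> J" for x
      proof -
        have x: "x \<in> carrier A" "model x \<in> I" using that by (auto simp: J_def)
        have "model x + model (\<ominus>\<^bsub>A\<^esub> x) = 0"
          using x(1) model_add[of x "\<ominus>\<^bsub>A\<^esub> x"] by (simp add: A.r_neg model_zero)
        then have "model (\<ominus>\<^bsub>A\<^esub> x) = model x * - 1"
          by (simp add: eq_neg_iff_add_eq_0 add.commute)
        with I(3)[OF x(2) S_minus[OF one_in_S]] x(1) show ?thesis by (simp add: J_def)
      qed
    qed
  qed (use I(3) model_in_S in \<open>auto simp: J_def model_mult mult.commute\<close>)
  moreover have "D ` J \<subseteq> J"
  proof
    fix y assume "y \<in> D ` J"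
    then obtain x where x: "y = D x" "x \<in> carrier A" "model x \<in> I" by (auto simp: J_def)
    have "D x \<in> carrier A" using D x(2) by (auto simp: derivations_def Let_def)
    moreover have "model (D x) \<in> I"
      using I(4)[OF x(3)] x(2) by (simp add: transport_def inv_model_model)
    ultimately show "y \<in> J" by (simp add: J_def x(1))
  qed
  ultimately have "J = {\<zero>\<^bsub>A\<^esub>} \<or> J = carrier A" by (rule ideals)
  then show "I = {0} \<or> I = S"
    unfolding I_J using model_bij by (auto simp: model_zero bij_betw_def)
qed

lemma automorphism_transport:
  assumes "\<sigma> \<in> algebra_automorphisms c q"
  shows "inverse_automorphisms (transport \<sigma>) (transport (inv_into (carrier A) \<sigma>))"
proof -
  define \<tau> where "\<tau> = inv_into (carrier A) \<sigma>"
  have hom: "\<sigma> \<in> ring_hom A A" and bij: "bij_betw \<sigma> (carrier A) (carrier A)"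
    and scalar: "\<sigma> (scalar c q a) = scalar c q a" for a
    using assms by (auto simp: algebra_automorphisms_def Let_def Bij_def)
  have closed: "\<sigma> x \<in> carrier A" "\<tau> x \<in> carrier A" "\<sigma> (\<tau> x) = x" "\<tau> (\<sigma> x) = x"
    if "x \<in> carrier A" for x
    using bij that by (auto simp: \<tau>_def bij_betw_def inv_into_into f_inv_into_f)
  have inv: "transport \<sigma> f \<in> S" "transport \<tau> f \<in> S" "transport \<sigma> (transport \<tau> f) = f"
    "transport \<tau> (transport \<sigma> f) = f" if "f \<in> S" for f
    using that by (simp_all add: transport_def inv_model inv_model_model closed model_in_S)
  have \<sigma>: "algebra_hom (transport \<sigma>)"
    using ring_hom_memE[OF hom]
    by (simp add: algebra_hom_def transport_def inv_model_add inv_model_mult inv_model inv_model_const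
        scalar model_scalar model_add model_mult closed)
  have \<tau>_eqI: "transport \<tau> f = g" if "g \<in> S" "transport \<sigma> g = f" for f g
    using inv(4) that by blast
  have "algebra_hom (transport \<tau>)"
    unfolding algebra_hom_def
    by (intro conjI ballI allI \<tau>_eqI S_add S_mult inv const_in_S)
      (simp_all add: algebra_hom_add[OF \<sigma>] algebra_hom_mult[OF \<sigma>] algebra_hom_const[OF \<sigma>] inv)
  with \<sigma> inv show ?thesis
    by (simp add: inverse_automorphisms_def \<tau>_def)
qed

theorem isotropy_group_trivial:
  assumes D: "simple_derivation c q D"
    and q00: "coeff (coeff q 0) 0 \<noteq> 0" and q10: "coeff (coeff q 0) 1 \<noteq> 0"
  shows "isotropy_group c q D = {\<lambda>f \<in> carrier A. f}"
proof (intro equalityI subsetI)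
  have D_closed: "D x \<in> carrier A" if "x \<in> carrier A" for x
    using D that by (auto simp: simple_derivation_def derivations_def Let_def)
  fix \<sigma>
  assume "\<sigma> \<in> isotropy_group c q D"
  then have aut: "\<sigma> \<in> algebra_automorphisms c q"
    and comp: "compose (carrier A) \<sigma> D = compose (carrier A) D \<sigma>"
    by (auto simp: isotropy_group_def Let_def)
  have ext: "\<sigma> \<in> extensional (carrier A)" and closed: "\<sigma> x \<in> carrier A" if "x \<in> carrier A" for x
    using aut that by (auto simp: algebra_automorphisms_def Let_def Bij_def bij_betw_def)
  have comm: "\<sigma> (D x) = D (\<sigma> x)" if "x \<in> carrier A" for x
    using fun_cong[OF comp, of x] that by (simp add: compose_def)
  have "transport \<sigma> (transport D f) = transport D (transport \<sigma> f)" if "f \<in> S" for f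
    using that by (simp add: transport_def inv_model inv_model_model D_closed closed comm)
  from commuting_automorphism_trivial[OF simple_transport[OF D] automorphism_transport[OF aut] this q00 q10]
  have fixed: "transport \<sigma> f = f" if "f \<in> S" for f using that by simp
  have "\<sigma> x = x" if x: "x \<in> carrier A" for x
  proof -
    have "model (\<sigma> x) = model x"
      using fixed[OF model_in_S[OF x]] by (simp add: transport_def inv_model_model x)
    then show ?thesis by (simp add: model_eq_iff closed x)
  qed
  moreover have "\<sigma> \<in> extensional (carrier A)"
    using aut by (auto simp: algebra_automorphisms_def Let_def Bij_def)
  ultimately have "\<sigma> = (\<lambda>f \<in> carrier A. f)"
    by (intro extensionalityI[of _ "carrier A"]) auto
  then show "\<sigma> \<in> {\<lambda>f \<in> carrier A. f}" by simp
next
  have D_closed: "D \<in> carrier A \<rightarrow>\<^sub>E carrier A"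
    using D by (auto simp: simple_derivation_def derivations_def Let_def)
  fix \<sigma> assume "\<sigma> \<in> {\<lambda>f \<in> carrier A. f}"
  then have \<sigma>: "\<sigma> = (\<lambda>f \<in> carrier A. f)" by simp
  have "\<sigma> \<in> ring_hom A A" by (rule ring_hom_memI) (simp_all add: \<sigma>)
  moreover have "bij_betw \<sigma> (carrier A) (carrier A)"
    by (auto simp: \<sigma> bij_betw_def inj_on_def)
  ultimately have "\<sigma> \<in> algebra_automorphisms c q"
    by (auto simp: algebra_automorphisms_def Let_def Bij_def scalar_in_carrier \<sigma>)
  moreover have "compose (carrier A) \<sigma> D = compose (carrier A) D \<sigma>"
    using D_closed by (auto simp: compose_def \<sigma> fun_eq_iff)
  ultimately show "\<sigma> \<in> isotropy_group c q D"
    by (simp add: isotropy_group_def Let_def)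
qed

end

lemma danielewski_reduced_pair:
  fixes c :: "'a::field_char_0 poly"
  assumes "(c, q) \<in> reduced_pairs n d" "n \<ge> 2" "d \<ge> 2"
  obtains l where "danielewski c q n d l"
proof -
  obtain l r where l: "l \<noteq> 0" and c: "degree c = n" "coeff c (n - 1) = 0"
    and q: "q = monom (monom l 0) d + (\<Sum>i<n. \<Sum>j\<le>d - 2. monom (monom (r i j) i) j)"
    using assms by (auto simp: reduced_pairs_def)
  have coeff_q: "coeff (coeff q b) a = (if b = d then if a = 0 then l else 0
          else if a < n \<and> b \<le> d - 2 then r a b else 0)" for a b
    unfolding q by (rule coeff_reduced_q[OF assms(3)])
  have top: "coeff q d = [:l:]"
    by (rule poly_eqI) (simp add: coeff_q coeff_pCons split: nat.splits)
  have zero: "coeff q b = 0" if "b \<noteq> d" "b > d - 2" for b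
    by (rule poly_eqI) (use that in \<open>simp add: coeff_q\<close>)
  have "degree q = d"
    using top l assms zero by (intro antisym degree_le le_degree) auto
  moreover have "degree (coeff q b) < n" for b
    using assms by (intro degree_lessI) (auto simp: coeff_q)
  ultimately have "danielewski c q n d l"
    using assms c l top zero[of "d - 1"] by unfold_locales auto
  with that show ?thesis .
qed

theorem corollary20:
  fixes n d :: nat
  assumes "n \<ge> 2" and "d \<ge> 2"
  shows "\<exists>U :: ('a::{alg_closed_field, field_char_0} poly \<times> 'a poly poly) set.
           openin (parameter_space n d) U \<and> U \<noteq> {} \<and>
           (\<forall>(c, q) \<in> U. \<forall>D. simple_derivation c q D \<longrightarrow>
              isotropy_group c q D = {\<lambda>f \<in> carrier (surface_algebra c q). f})"
proof -
  define V :: "(coordinate \<Rightarrow> 'a) set" where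
    "V = (coordinates n d \<rightarrow>\<^sub>E UNIV) - zero_locus (coordinates n d) {\<lambda>v. v (Q 0 0) * v (Q 1 0)}"
  define U where "U = coords n d -` V \<inter> reduced_pairs n d"
  have Q: "Q 0 0 \<in> coordinates n d" "Q 1 0 \<in> coordinates n d"
    using assms by (auto simp: coordinates_def)
  then have "openin (zariski_topology (coordinates n d)) V"
    unfolding openin_zariski_iff V_def
    by (intro exI[of _ "{\<lambda>v. v (Q 0 0) * v (Q 1 0)}"])
      (auto intro!: polynomial_functions.intros)
  then have "openin (parameter_space n d) U"
    unfolding parameter_space_def openin_pullback_topology U_def by blast
  moreover have U_iff: "(c, q) \<in> U \<longleftrightarrow> (c, q) \<in> reduced_pairs n d \<and>
      coeff (coeff q 0) 0 \<noteq> 0 \<and> coeff (coeff q 0) 1 \<noteq> 0" for c :: "'a poly" and q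
    using Q by (auto simp: U_def V_def zero_locus_def coords_def)
  have "U \<noteq> {}"
  proof -
    define q :: "'a poly poly" where
      "q = monom (monom 1 0) d + (\<Sum>i<n. \<Sum>j\<le>d - 2. monom (monom 1 i) j)"
    have "(monom 1 n, q) \<in> reduced_pairs n d"
      using assms by (auto simp: reduced_pairs_def q_def degree_monom_eq intro!: exI[of _ 1] exI[of _ "\<lambda>_ _. 1"])
    moreover have "coeff (coeff q b) a = (if b = d then if a = 0 then 1 else 0
          else if a < n \<and> b \<le> d - 2 then 1 else 0)" for a b
      unfolding q_def by (rule coeff_reduced_q[OF assms(2)])
    ultimately have "(monom 1 n, q) \<in> U" using assms by (simp add: U_iff)
    then show ?thesis by blast
  qed
  moreover have "isotropy_group c q D = {\<lambda>f \<in> carrier (surface_algebra c q). f}"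
    if cq: "(c, q) \<in> U" "simple_derivation c q D" for c q D
  proof -
    obtain l where "danielewski c q n d l"
      using danielewski_reduced_pair[OF _ assms] cq(1) unfolding U_iff by blast
    then show ?thesis
      using danielewski.isotropy_group_trivial cq unfolding U_iff by blast
  qed
  ultimately show ?thesis by blast
qed

end
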